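(* Assume $(E,\nabla)\in\mathcal V$ and let $Q=\mathrm{App}(E,\nabla)$. Then the transformed connection $(\phi_\nabla)_*\nabla$ on $E_0=\mathcal O\oplus\Omega^1(D)$ has polar divisor $D+Q$, and is equivalent, up to bundle automorphisms of $E_0$, to a unique connection $\nabla_0$ satisfying: (1) the restriction of $\nabla_0$ to the first factor $\mathcal O\subset E_0$ is the trivial connection, $\nabla_0|_{\mathcal O}\equiv0$; (2) the morphism $\varphi_{\nabla_0}:\Omega^1(D)\to\Omega^1(D)$ defined by the "cyclic vector" $\Omega^1(D)\subset E_0$ is the identity, $\varphi_{\nabla_0}=\mathrm{id}_{\Omega^1(D)}$. Moreover, at each point of $Q$, the residual eigenvalues of $\nabla_0$ are $-1$ and $0$, and the $(-1)$-eigendirection is contained in the subbundle $\Omega^1(D)$.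
   Context: Everything is over $\mathbb C$. Write $\mathcal O,\mathcal O(k),\Omega^1$ for the line bundles on $\mathbb P^1$. **Connections and formal data.** $D=\sum_i n_i[t_i]$ with distinct points $t_i$, $n_i\ge 1$, $n=\deg D\geq 3$. A rank $2$ meromorphic connection $(E,\nabla)$ with polar divisor $D$ is a rank $2$ holomorphic vector bundle $E\to\mathbb P^1$ with a $\mathbb C$-linear map $\nabla:E\to E\otimes\Omega^1(D)$ satisfying $\nabla(fs)=s\otimes df+f\nabla s$. In a local trivialization $\nabla=d+\Omega$ with $\Omega$ a $2\times2$ matrix of meromorphic $1$-forms. The formal data of $\nabla$ at $t_i$ is $\Lambda_{t_i}(\nabla)=(\mathrm{tr}(\nabla)^{<0}_{t_i},\det(\nabla)^{<-n_i}_{t_i})$, where the first term is the class of $\mathrm{tr}\,\Omega$ in germs of $\Omega^1(D)/\Omega^1$ and the second is the class of $\det\Omega$ in germs of $(\Omega^1(D))^{\otimes2}/(\Omega^1)^{\otimes 2}(D)$. $\Lambda$ denotes a fixed collection of such data at all $t_i$; it satisfies the Fuchs relation $\sum_i\mathrm{Res}_{t_i}\mathrm{tr}(\nabla)^{<0}_{t_i}=-\deg E=-1$, and poles are reduced: leading coefficients are non-scalar, and at poles with $n_i>1$ the discriminant $\mathrm{tr}^2-4\det$ has pole order $2n_i$ (unramified case) or $2n_i-1$ (ramified case). A $\Lambda$-connection is a connection $(E,\nabla)$ with polar divisor $D$, $\deg E=1$ and formal data $\Lambda$. **Moduli space.** $\mathcal M_{\boldsymbol\mu}^\Lambda$ is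 the moduli space of $\boldsymbol\mu$-stable parabolic $\Lambda$-connections for a convenient fixed choice of weights $\boldsymbol\mu$ (for generic $\Lambda$ it is just the moduli space of $\Lambda$-connections up to isomorphism; the parabolic structure and weights play no role in the present statement). One writes $(E,\nabla)$ for its points. **Open sets and apparent map.** $\mathcal U\subset\mathcal M_{\boldsymbol\mu}^\Lambda$ is the Zariski open set of $(E,\nabla)$ with $E\simeq\mathcal O\oplus\mathcal O(1)$ and $L:=\mathcal O(1)$ not $\nabla$-invariant. For $(E,\nabla)\in\mathcal U$ let $\varphi_\nabla$ be the nonzero $\mathcal O$-linear composition $L\hookrightarrow E\xrightarrow{\nabla}E\otimes\Omega^1(D)\to(E/L)\otimes\Omega^1(D)\simeq\Omega^1(D)$, and $\mathrm{App}(E,\nabla)=\mathrm{div}(\varphi_\nabla)\in|\mathcal O(n-3)|$. Let $W\subset|\mathcal O(n-3)|$ be the set of reduced divisors with support disjoint from $D$, and $\mathcal V=\mathcal U\cap\mathrm{App}^{-1}(W)$. **Transformation.** For $(E,\nabla)\in\mathcal V$, $\phi_\nabla=\mathrm{id}\oplus\varphi_\nabla:\mathcal O\oplus\mathcal O(1)\dashrightarrow E_0=\mathcal O\oplus\Omega^1(D)$ is a birational bundle transformation, and $(\phi_\nabla)_*\nabla$ is the pushed-forward connection. **Meaning of the normalizations.** $\nabla_0|_{\mathcal O}\equiv0$ means that the composition $\mathcal O\hookrightarrow E_0\xrightarrow{\nabla_0}E_0\otimes\Omega^1(D+Q)\to\mathcal O\otimes\Omega^1(D+Q)$ (projection to the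 first factor) is the trivial connection $d$, i.e. the $(1,1)$-coefficient of the connection matrix vanishes. The morphism $\varphi_{\nabla_0}$ is the composition $\Omega^1(D)\hookrightarrow E_0\xrightarrow{\nabla_0}E_0\otimes\Omega^1(D+Q)\to(E_0/\Omega^1(D))\otimes\Omega^1(D+Q)\simeq\Omega^1(D+Q)$, which takes values in $\Omega^1(D)$. Residual eigenvalues at a simple pole are the eigenvalues of the residue of the connection matrix. *)

theory Defs
  imports "HOL-Complex_Analysis.Complex_Analysis" "HOL-Library.Multiset"
begin

section \<open>The projective line\<close>

datatype p1 = Pt complex | Infty

text \<open>The two standard affine charts: coordinate \<open>z\<close> on \<open>U0\<close>, coordinate \<open>w = 1/z\<close> on \<open>U1\<close>.\<close>

datatype chart = U0 | U1

fun pt :: "chart \<Rightarrow> complex \<Rightarrow> p1" where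
  "pt U0 z = Pt z"
| "pt U1 w = (if w = 0 then Infty else Pt (1 / w))"

text \<open>Local notions at a point \<open>p\<close> are computed in one chosen chart around \<open>p\<close>.\<close>

fun chart_at :: "p1 \<Rightarrow> chart" where
  "chart_at (Pt z) = U0"
| "chart_at Infty = U1"

fun coord_at :: "p1 \<Rightarrow> complex" where
  "coord_at (Pt z) = z"
| "coord_at Infty = 0"

text \<open>
  An effective divisor is a finite multiset of points; its degree is \<open>size D\<close> and the
  multiplicity of \<open>p\<close> is \<open>count D p\<close>. The function \<open>local_eq D c\<close> is a polynomial equation
  of \<open>D\<close> in the chart \<open>c\<close>, so that \<open>dx / local_eq D c x\<close> generates the sheaf of 1-forms
  with poles bounded by \<open>D\<close> over that chart (\<open>x\<close> the coordinate of \<open>c\<close>).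
\<close>

fun local_factor :: "chart \<Rightarrow> p1 \<Rightarrow> complex \<Rightarrow> complex" where
  "local_factor U0 (Pt t) z = z - t"
| "local_factor U0 Infty z = 1"
| "local_factor U1 (Pt t) w = (if t = 0 then 1 else w - 1 / t)"
| "local_factor U1 Infty w = w"

definition local_eq :: "p1 multiset \<Rightarrow> chart \<Rightarrow> complex \<Rightarrow> complex" where
  "local_eq D c x = (\<Prod>p\<in>#D. local_factor c p x)"

section \<open>Holomorphic matrix functions\<close>

type_synonym mat2 = "complex^2^2"

definition mat_holomorphic_on :: "(complex \<Rightarrow> mat2) \<Rightarrow> complex set \<Rightarrow> bool" where
  "mat_holomorphic_on M S \<longleftrightarrow> (\<forall>i j. (\<lambda>x. M x $ i $ j) holomorphic_on S)"

definition mat_deriv :: "(complex \<Rightarrow> mat2) \<Rightarrow> complex \<Rightarrow> mat2" where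
  "mat_deriv M x = (\<chi> i j. deriv (\<lambda>y. M y $ i $ j) x)"

definition diag2 :: "complex \<Rightarrow> complex \<Rightarrow> mat2" where
  "diag2 a b = vector [vector [a, 0], vector [0, b]]"

text \<open>
  Coefficient of \<open>(y - x)\<close> to the power \<open>-k\<close> (with \<open>k \<ge> 1\<close>) of a matrix function at \<open>x\<close>,
  when the pole order is at most \<open>k\<close>; for \<open>k = 1\<close> it is the residue matrix.
\<close>

definition polar_coeff :: "nat \<Rightarrow> (complex \<Rightarrow> mat2) \<Rightarrow> complex \<Rightarrow> mat2" where
  "polar_coeff k M x = (\<chi> i j. residue (\<lambda>y. (y - x) ^ (k - 1) * M y $ i $ j) x)"

section \<open>Rank 2 bundles and their morphisms\<close>

text \<open>
  A rank 2 bundle is given by a frame over each chart (holomorphic bundles over the affine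
  line are trivial) and its clutching matrix \<open>g\<close>: the coordinate vectors of a section in the
  two frames are related by \<open>s U0 z = g z *v s U1 (1/z)\<close>. Line bundles are given likewise by
  a scalar clutching function.
\<close>

type_synonym clutching = "complex \<Rightarrow> mat2"

definition is_bundle :: "clutching \<Rightarrow> bool" where
  "is_bundle g \<longleftrightarrow> mat_holomorphic_on g (- {0}) \<and> (\<forall>z. z \<noteq> 0 \<longrightarrow> det (g z) \<noteq> 0)"

text \<open>The degree is the degree of the determinant line bundle.\<close>

definition has_degree :: "clutching \<Rightarrow> int \<Rightarrow> bool" where
  "has_degree g d \<longleftrightarrow> winding_number (\<lambda>t. det (g (circlepath 0 1 t))) 0 = of_int d"

definition direct_sum :: "(complex \<Rightarrow> complex) \<Rightarrow> (complex \<Rightarrow> complex) \<Rightarrow> clutching" where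
  "direct_sum l m z = diag2 (l z) (m z)"

definition O_bundle :: "int \<Rightarrow> complex \<Rightarrow> complex" where
  "O_bundle k z = z powi k"

text \<open>
  The line bundle of 1-forms with poles bounded by \<open>D\<close>, with frames \<open>dz / local_eq D U0 z\<close>
  and \<open>dw / local_eq D U1 w\<close>. Since \<open>dw = - dz / z^2\<close>, its clutching function is
  \<open>- local_eq D U0 z / (z^2 * local_eq D U1 (1/z))\<close>, in which the zeros on the support of \<open>D\<close>
  cancel; the product below is the quotient after cancellation.
\<close>

fun local_ratio :: "p1 \<Rightarrow> complex \<Rightarrow> complex" where
  "local_ratio (Pt t) z = (if t = 0 then z else - t * z)"
| "local_ratio Infty z = z"

lemma local_eq_ratio:
  assumes "z \<noteq> 0"
  shows "local_eq D U0 z = (\<Prod>p\<in>#D. local_ratio p z) * local_eq D U1 (1 / z)"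
proof -
  have "local_factor U0 p z = local_ratio p z * local_factor U1 p (1 / z)" for p
    using assms by (cases p) (auto simp: field_simps)
  then show ?thesis
    by (simp add: local_eq_def prod_mset.distrib)
qed

definition Omega_bundle :: "p1 multiset \<Rightarrow> complex \<Rightarrow> complex" where
  "Omega_bundle D z = - (\<Prod>p\<in>#D. local_ratio p z) / z\<^sup>2"

lemma is_bundle_direct_sum:
  assumes "l holomorphic_on - {0}" "m holomorphic_on - {0}"
    and "\<And>z. z \<noteq> 0 \<Longrightarrow> l z \<noteq> 0" "\<And>z. z \<noteq> 0 \<Longrightarrow> m z \<noteq> 0"
  shows "is_bundle (direct_sum l m)"
  using assms
  by (auto simp: is_bundle_def mat_holomorphic_on_def direct_sum_def diag2_def forall_2 det_2)

lemma O_bundle_holomorphic: "O_bundle k holomorphic_on - {0}"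
  unfolding O_bundle_def [abs_def] by (auto intro!: holomorphic_intros)

lemma is_bundle_O_O1: "is_bundle (direct_sum (O_bundle 0) (O_bundle 1))"
  by (intro is_bundle_direct_sum O_bundle_holomorphic) (auto simp: O_bundle_def)

lemma is_bundle_O_Omega: "is_bundle (direct_sum (O_bundle 0) (Omega_bundle D))"
proof (rule is_bundle_direct_sum)
  have "(\<lambda>z. \<Prod>p\<in>#D. local_ratio p z) holomorphic_on - {0}"
  proof (induction D)
    case (add p D)
    have "local_ratio p holomorphic_on - {0}"
    proof (cases p)
      case (Pt t)
      then show ?thesis
        by (cases "t = 0") (auto simp: fun_eq_iff intro!: holomorphic_intros
              intro: holomorphic_transform[of "\<lambda>z. z"] holomorphic_transform[of "\<lambda>z. - t * z"])
    next
      case Infty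
      then show ?thesis
        by (auto intro: holomorphic_transform[of "\<lambda>z. z"])
    qed
    with add show ?case
      by (auto intro!: holomorphic_intros)
  qed auto
  then show "Omega_bundle D holomorphic_on - {0}"
    unfolding Omega_bundle_def by (auto intro!: holomorphic_intros)
  show "Omega_bundle D z \<noteq> 0" if "z \<noteq> 0" for z
  proof -
    have "local_ratio p z \<noteq> 0" for p using that by (cases p) auto
    then show ?thesis using that by (auto simp: Omega_bundle_def prod_mset_zero_iff)
  qed
qed (auto simp: O_bundle_holomorphic, simp add: O_bundle_def)

definition bundle_hom :: "clutching \<Rightarrow> clutching \<Rightarrow> (chart \<Rightarrow> complex \<Rightarrow> mat2) \<Rightarrow> bool" where
  "bundle_hom g g' h \<longleftrightarrow>
     (\<forall>c. mat_holomorphic_on (h c) UNIV) \<and>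
     (\<forall>z. z \<noteq> 0 \<longrightarrow> h U0 z ** g z = g' z ** h U1 (1 / z))"

definition bundle_iso :: "clutching \<Rightarrow> clutching \<Rightarrow> (chart \<Rightarrow> complex \<Rightarrow> mat2) \<Rightarrow> bool" where
  "bundle_iso g g' h \<longleftrightarrow> bundle_hom g g' h \<and> (\<forall>c x. det (h c x) \<noteq> 0)"

section \<open>Meromorphic connections\<close>

text \<open>
  In the frame over the chart \<open>c\<close> with coordinate \<open>x\<close> the connection is \<open>d + A c x dx\<close>. The
  first condition says that \<open>A c x dx\<close> has coefficients in the 1-forms with poles bounded by
  \<open>D\<close>; since \<open>local_eq D c\<close> vanishes on \<open>D\<close> and \<open>b / 0 = 0\<close>, it also fixes the otherwise
  meaningless values of \<open>A\<close> on \<open>D\<close> to be zero, so that equality of connections is equality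
  of functions. The second condition is \<open>g (A U1 dw) = (A U0 dz) g + dg\<close>.
\<close>

type_synonym connection_matrix = "chart \<Rightarrow> complex \<Rightarrow> mat2"

definition is_connection :: "p1 multiset \<Rightarrow> clutching \<Rightarrow> connection_matrix \<Rightarrow> bool" where
  "is_connection D g A \<longleftrightarrow>
     (\<forall>c. \<exists>B. mat_holomorphic_on B UNIV \<and>
              (\<forall>x i j. A c x $ i $ j = B x $ i $ j / local_eq D c x)) \<and>
     (\<forall>z. z \<noteq> 0 \<and> Pt z \<notin># D \<longrightarrow>
          g z ** (mat (- 1 / z\<^sup>2) ** A U1 (1 / z)) = A U0 z ** g z + mat_deriv g z)"

text \<open>Here the pole order at each point of \<open>D\<close> is exactly its multiplicity.\<close>

definition has_exact_polar_divisor ::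
    "p1 multiset \<Rightarrow> clutching \<Rightarrow> connection_matrix \<Rightarrow> bool" where
  "has_exact_polar_divisor D g A \<longleftrightarrow> is_connection D g A \<and>
     (\<forall>p\<in>#D. polar_coeff (count D p) (A (chart_at p)) (coord_at p) \<noteq> 0)"

text \<open>
  Push-forward of \<open>d + A\<close> by a bundle transformation \<open>G\<close> which is holomorphic, and
  invertible outside the support of \<open>D\<close>: the connection \<open>d + A'\<close> such that
  \<open>(d + A') G s = G (d + A) s\<close>, normalized to be zero on \<open>D\<close>.
\<close>

definition push_forward ::
    "p1 multiset \<Rightarrow> (chart \<Rightarrow> complex \<Rightarrow> mat2) \<Rightarrow> connection_matrix \<Rightarrow> connection_matrix" where
  "push_forward D G A c x =
     (if pt c x \<in># D then 0
      else (G c x ** A c x - mat_deriv (G c) x) ** matrix_inv (G c x))"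

text \<open>Equivalence of connections with poles in \<open>D\<close> up to automorphisms of the bundle \<open>g\<close>.\<close>

definition aut_equivalent ::
    "p1 multiset \<Rightarrow> clutching \<Rightarrow> connection_matrix \<Rightarrow> connection_matrix \<Rightarrow> bool" where
  "aut_equivalent D g A A' \<longleftrightarrow> (\<exists>h. bundle_iso g g h \<and> A' = push_forward D h A)"

section \<open>Formal data\<close>

definition same_class ::
    "nat \<Rightarrow> complex \<Rightarrow> (complex \<Rightarrow> complex) \<Rightarrow> (complex \<Rightarrow> complex) \<Rightarrow> bool" where
  "same_class m x f f' \<longleftrightarrow>
     (\<exists>h. h analytic_on {x} \<and> (\<forall>\<^sub>F y in at x. f y - f' y = h y / (y - x) ^ m))"

text \<open>
  Formal data at \<open>p\<close> are given by representatives, in the chosen coordinate at \<open>p\<close>, of the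
  class of the trace modulo holomorphic forms, and of the class of the determinant modulo
  quadratic differentials with poles bounded by \<open>D\<close>.
\<close>

type_synonym formal_data = "p1 \<Rightarrow> (complex \<Rightarrow> complex) \<times> (complex \<Rightarrow> complex)"

definition has_formal_data :: "p1 multiset \<Rightarrow> formal_data \<Rightarrow> connection_matrix \<Rightarrow> bool" where
  "has_formal_data D \<Lambda> A \<longleftrightarrow>
     (\<forall>p\<in>#D. same_class 0 (coord_at p) (\<lambda>x. trace (A (chart_at p) x)) (fst (\<Lambda> p)) \<and>
              same_class (count D p) (coord_at p) (\<lambda>x. det (A (chart_at p) x)) (snd (\<Lambda> p)))"

definition fuchs_relation :: "p1 multiset \<Rightarrow> formal_data \<Rightarrow> int \<Rightarrow> bool" where
  "fuchs_relation D \<Lambda> d \<longleftrightarrow>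
     (\<Sum>p\<in>set_mset D. residue (fst (\<Lambda> p)) (coord_at p)) = - of_int d"

definition discriminant :: "mat2 \<Rightarrow> complex" where
  "discriminant M = (trace M)\<^sup>2 - 4 * det M"

definition poles_reduced :: "p1 multiset \<Rightarrow> connection_matrix \<Rightarrow> bool" where
  "poles_reduced D A \<longleftrightarrow>
     (\<forall>p\<in>#D. let n = count D p; x = coord_at p; M = A (chart_at p) in
        (\<nexists>a. polar_coeff n M x = mat a) \<and>
        (n > 1 \<longrightarrow> is_pole (\<lambda>y. discriminant (M y)) x \<and>
           zorder (\<lambda>y. discriminant (M y)) x \<in> {- 2 * int n, - (2 * int n - 1)}))"

definition Lambda_connection ::
    "p1 multiset \<Rightarrow> formal_data \<Rightarrow> clutching \<Rightarrow> connection_matrix \<Rightarrow> bool" where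
  "Lambda_connection D \<Lambda> g A \<longleftrightarrow>
     is_bundle g \<and> has_degree g 1 \<and> is_connection D g A \<and>
     has_formal_data D \<Lambda> A \<and> fuchs_relation D \<Lambda> 1 \<and> poles_reduced D A"

section \<open>Apparent map\<close>

text \<open>
  All of this is for connections on a direct sum of two line bundles, \<open>L\<close> being the second
  summand. The composition of the inclusion of \<open>L\<close>, the connection and the projection to
  the first summand is given by the entry \<open>(1,2)\<close> of the connection matrix.
\<close>

definition second_factor_invariant :: "connection_matrix \<Rightarrow> bool" where
  "second_factor_invariant A \<longleftrightarrow> (\<forall>c x. A c x $ 1 $ 2 = 0)"

text \<open>
  When the first summand is trivial, this composition takes values in the 1-forms with poles
  bounded by \<open>D\<close>; here it is written in the frame of \<open>L\<close> and the frame \<open>dx / local_eq D c x\<close>.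
\<close>

definition cyclic_morphism ::
    "p1 multiset \<Rightarrow> connection_matrix \<Rightarrow> chart \<Rightarrow> complex \<Rightarrow> complex" where
  "cyclic_morphism D A c = remove_sings (\<lambda>x. local_eq D c x * A c x $ 1 $ 2)"

definition divisor_of :: "(chart \<Rightarrow> complex \<Rightarrow> complex) \<Rightarrow> p1 multiset" where
  "divisor_of \<phi> = (THE Q. \<forall>p. int (count Q p) = zorder (\<phi> (chart_at p)) (coord_at p))"

definition App :: "p1 multiset \<Rightarrow> connection_matrix \<Rightarrow> p1 multiset" where
  "App D A = divisor_of (cyclic_morphism D A)"

text \<open>The birational transformation \<open>id \<oplus> \<phi>\<close>.\<close>

definition id_sum :: "(chart \<Rightarrow> complex \<Rightarrow> complex) \<Rightarrow> chart \<Rightarrow> complex \<Rightarrow> mat2" where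
  "id_sum \<phi> c x = diag2 1 (\<phi> c x)"

abbreviation E_source :: clutching where
  "E_source \<equiv> direct_sum (O_bundle 0) (O_bundle 1)"

abbreviation E_target :: "p1 multiset \<Rightarrow> clutching" where
  "E_target D \<equiv> direct_sum (O_bundle 0) (Omega_bundle D)"

text \<open>
  The two normalizations: the connection induced on the first factor is \<open>d\<close>, and the
  endomorphism of the bundle of 1-forms with poles bounded by \<open>D\<close> is the identity.
\<close>

definition is_normalized :: "p1 multiset \<Rightarrow> connection_matrix \<Rightarrow> bool" where
  "is_normalized D A \<longleftrightarrow>
     (\<forall>c x. A c x $ 1 $ 1 = 0) \<and> (\<forall>c x. cyclic_morphism D A c x = 1)"

section \<open>Residual eigenvalues\<close>

definition residue_matrix :: "connection_matrix \<Rightarrow> p1 \<Rightarrow> mat2" where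
  "residue_matrix A p = polar_coeff 1 (A (chart_at p)) (coord_at p)"

definition eigenvalues :: "mat2 \<Rightarrow> complex set" where
  "eigenvalues M = {a. \<exists>v. v \<noteq> 0 \<and> M *v v = a *s v}"

end

theory Submission
  imports Defs
begin

text \<open>
  Write the connection induced on \<open>\<O> \<oplus> \<O>(1)\<close> as \<open>A = B / d\<close>, where \<open>d\<close> is an equation of \<open>D\<close> and \<open>B\<close> is
  an entire matrix function in each chart, and put \<open>\<phi> = B\<^sub>1\<^sub>2\<close> and \<open>\<sigma> = B\<^sub>1\<^sub>1\<close>. The entry \<open>\<phi>\<close> is the
  cyclic morphism \<open>\<O>(1) \<rightarrow> \<Omega>\<^sup>1(D)\<close>, and \<open>Q\<close> is its divisor of zeros. The definition
  of \<open>Q\<close> is meaningful because \<open>\<phi>\<close> has finitely many zeros (\<open>count_divisor_of\<close>). Pushing forward by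
  \<open>id \<oplus> \<phi>\<close> gives the connection with entries
  \<open>\<sigma>/d\<close>, \<open>1/d\<close>, \<open>\<phi> B\<^sub>2\<^sub>1 / d\<close> and \<open>B\<^sub>2\<^sub>2/d - \<phi>'/\<phi>\<close>.
  Its entry \<open>1/d\<close> has the full pole order at the points of \<open>D\<close>, and the logarithmic derivative
  \<open>\<phi>'/\<phi>\<close> has simple poles with residue \<open>1\<close> at the simple zeros \<open>Q\<close>. Hence the polar divisor is exactly
  \<open>D + Q\<close> (\<open>transformed_exact_polar_divisor\<close>).

  Since \<open>\<Omega>\<^sup>1(D)\<close> has degree \<open>n - 2 > 0\<close>, Liouville's theorem shows that an automorphism of
  \<open>\<O> \<oplus> \<Omega>\<^sup>1(D)\<close> is lower triangular with constants \<open>a\<close>, \<open>b\<close> on the diagonal and a section \<open>f\<close> of \<open>\<Omega>\<^sup>1(D)\<close> in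
  the corner (\<open>endomorphism_O_Omega\<close>). It turns the first row \<open>(\<sigma>/d, 1/d)\<close> into \<open>((\<sigma> - f/b)/d, (a/b)/d)\<close>, so the two
  normalizations say precisely that \<open>a = b\<close> and \<open>f = b \<sigma>\<close>. Here \<open>\<sigma>\<close> really is a section of
  \<open>\<Omega>\<^sup>1(D)\<close>, because the first summand is trivial and so \<open>(\<sigma>/d) dx\<close> is a global form. This gives
  existence; it gives uniqueness too, because the remaining scalar \<open>b\<close> acts trivially on connections
  (\<open>normal_form_unique\<close>).

  In the normal form the first row is \<open>(0, 1/d)\<close>, which is holomorphic at \<open>Q\<close>, and the entry \<open>(2,2)\<close>
  still contains \<open>- \<phi>'/\<phi>\<close>. So the residue at a point of \<open>Q\<close> is lower triangular with
  diagonal \<open>(0, -1)\<close>, and its \<open>(-1)\<close>-eigenvectors span the second summand (\<open>normal_form_residue\<close>).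
\<close>

no_notation fps_nth (infixl "$" 75)

section \<open>Two by two matrices and matrix functions\<close>

lemma mat2_eq_iff:
  "(M :: mat2) = N \<longleftrightarrow>
     M $ 1 $ 1 = N $ 1 $ 1 \<and> M $ 1 $ 2 = N $ 1 $ 2 \<and> M $ 2 $ 1 = N $ 2 $ 1 \<and> M $ 2 $ 2 = N $ 2 $ 2"
  by (auto simp: vec_eq_iff forall_2)

lemma mat2_mult_nth: "((M :: mat2) ** N) $ i $ j = M $ i $ 1 * N $ 1 $ j + M $ i $ 2 * N $ 2 $ j"
  by (simp add: matrix_matrix_mult_def sum_2)

lemma mat2_diff_rdistrib: "((M :: mat2) - N) ** (K :: mat2) = M ** K - N ** K"
  by (simp add: mat2_eq_iff mat2_mult_nth left_diff_distrib)

lemma mat2_add_rdistrib: "((M :: mat2) + N) ** (K :: mat2) = M ** K + N ** K"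
  by (simp add: mat2_eq_iff mat2_mult_nth distrib_right)

lemma mat2_mat_nth: "(mat a :: mat2) $ i $ j = (if i = j then a else 0)"
  by (simp add: mat_def)

definition lower_triangular :: "complex \<Rightarrow> complex \<Rightarrow> complex \<Rightarrow> mat2" where
  "lower_triangular a f b = vector [vector [a, 0], vector [f, b]]"

lemma lower_triangular_nth [simp]:
  "lower_triangular a f b $ 1 $ 1 = a" "lower_triangular a f b $ 1 $ 2 = 0"
  "lower_triangular a f b $ 2 $ 1 = f" "lower_triangular a f b $ 2 $ 2 = b"
  by (simp_all add: lower_triangular_def)

lemma diag2_nth [simp]:
  "diag2 a b $ 1 $ 1 = a" "diag2 a b $ 1 $ 2 = 0" "diag2 a b $ 2 $ 1 = 0" "diag2 a b $ 2 $ 2 = b"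
  by (simp_all add: diag2_def)

lemma diag2_eq_lower_triangular: "diag2 a b = lower_triangular a 0 b"
  by (simp add: diag2_def lower_triangular_def)

lemma det_lower_triangular [simp]: "det (lower_triangular a f b) = a * b"
  by (simp add: det_2)

lemma matrix_inv_mult:
  fixes M :: mat2
  assumes "det M \<noteq> 0"
  shows "matrix_inv M ** M = mat 1" "M ** matrix_inv M = mat 1"
proof -
  have "invertible M"
    using assms by (simp add: invertible_det_nz)
  then have "\<exists>N. M ** N = mat 1 \<and> N ** M = mat 1"
    by (simp add: invertible_def)
  then have "M ** matrix_inv M = mat 1 \<and> matrix_inv M ** M = mat 1"
    unfolding matrix_inv_def by (rule someI_ex)
  then show "matrix_inv M ** M = mat 1" "M ** matrix_inv M = mat 1"
    by auto
qed

lemma matrix_inv_unique: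
  fixes M N :: mat2
  assumes "det M \<noteq> 0" "M ** N = mat 1"
  shows "matrix_inv M = N"
  by (metis assms matrix_inv_mult(1) matrix_mul_assoc matrix_mul_lid matrix_mul_rid)

lemma matrix_inv_nth:
  fixes M :: mat2
  assumes "det M \<noteq> 0"
  shows "matrix_inv M $ 1 $ 1 = M $ 2 $ 2 / det M" "matrix_inv M $ 1 $ 2 = - M $ 1 $ 2 / det M"
    "matrix_inv M $ 2 $ 1 = - M $ 2 $ 1 / det M" "matrix_inv M $ 2 $ 2 = M $ 1 $ 1 / det M"
proof -
  have det: "M $ 1 $ 1 * M $ 2 $ 2 = det M + M $ 1 $ 2 * M $ 2 $ 1"
    by (simp add: det_2)
  have "matrix_inv M = vector [vector [M $ 2 $ 2 / det M, - M $ 1 $ 2 / det M],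
                               vector [- M $ 2 $ 1 / det M, M $ 1 $ 1 / det M]]" (is "_ = ?N")
  proof (rule matrix_inv_unique[OF assms])
    show "M ** ?N = mat 1"
      using assms by (simp add: mat2_eq_iff mat2_mult_nth mat2_mat_nth det field_simps)
  qed
  then show "matrix_inv M $ 1 $ 1 = M $ 2 $ 2 / det M" "matrix_inv M $ 1 $ 2 = - M $ 1 $ 2 / det M"
    "matrix_inv M $ 2 $ 1 = - M $ 2 $ 1 / det M" "matrix_inv M $ 2 $ 2 = M $ 1 $ 1 / det M"
    by simp_all
qed

lemma mat2_mult_right_cancel:
  fixes M X Y :: mat2
  assumes "det M \<noteq> 0" "X ** M = Y ** M"
  shows "X = Y"
  by (metis assms matrix_inv_mult(2) matrix_mul_assoc matrix_mul_rid)

lemma mat_deriv_nth: "mat_deriv M x $ i $ j = deriv (\<lambda>y. M y $ i $ j) x"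
  by (simp add: mat_deriv_def)

lemma mat_deriv_lower_triangular:
  "mat_deriv (\<lambda>x. lower_triangular (a x) (f x) (b x)) x = lower_triangular (deriv a x) (deriv f x) (deriv b x)"
  by (simp add: mat2_eq_iff mat_deriv_nth)

lemma mat_deriv_mult:
  assumes "\<And>i j. (\<lambda>y. M y $ i $ j) field_differentiable at x"
    and "\<And>i j. (\<lambda>y. N y $ i $ j) field_differentiable at x"
  shows "mat_deriv (\<lambda>y. M y ** N y) x = mat_deriv M x ** N x + M x ** mat_deriv N x"
  using assms
  by (simp add: vec_eq_iff mat_deriv_nth mat2_mult_nth deriv_add deriv_mult
      field_differentiable_mult algebra_simps)

lemma mat_deriv_inverse:
  assumes "z \<noteq> 0" "\<And>i j. (\<lambda>y. M y $ i $ j) field_differentiable at (1 / z)"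
  shows "mat_deriv (\<lambda>y. M (1 / y)) z = mat (- 1 / z\<^sup>2) ** mat_deriv M (1 / z)"
proof -
  have "deriv (\<lambda>y. M (1 / y) $ i $ j) z = (- 1 / z\<^sup>2) * deriv (\<lambda>y. M y $ i $ j) (1 / z)" for i j
  proof (rule DERIV_imp_deriv)
    have "((\<lambda>y. M y $ i $ j) has_field_derivative deriv (\<lambda>y. M y $ i $ j) (1 / z)) (at (1 / z))"
      using assms(2) by (simp add: DERIV_deriv_iff_field_differentiable)
    moreover have "((\<lambda>y. 1 / y) has_field_derivative - 1 / z\<^sup>2) (at z)"
      using assms(1) by (auto intro!: derivative_eq_intros simp: power2_eq_square)
    ultimately show "((\<lambda>y. M (1 / y) $ i $ j) has_field_derivative
        - 1 / z\<^sup>2 * deriv (\<lambda>y. M y $ i $ j) (1 / z)) (at z)"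
      by (subst mult.commute) (rule DERIV_chain2)
  qed
  then show ?thesis
    by (simp add: vec_eq_iff mat_deriv_nth mat2_mult_nth mat2_mat_nth forall_2)
qed

lemma mat_holomorphic_on_differentiable:
  assumes "mat_holomorphic_on M S" "open S" "x \<in> S"
  shows "(\<lambda>y. M y $ i $ j) field_differentiable at x"
  using assms by (auto simp: mat_holomorphic_on_def intro: holomorphic_on_imp_differentiable_at)

lemma mat_holomorphic_on_mult:
  "mat_holomorphic_on M S \<Longrightarrow> mat_holomorphic_on N S \<Longrightarrow> mat_holomorphic_on (\<lambda>x. M x ** N x) S"
  by (auto simp: mat_holomorphic_on_def mat2_mult_nth intro!: holomorphic_intros)

lemma mat_holomorphic_on_diff:
  "mat_holomorphic_on M S \<Longrightarrow> mat_holomorphic_on N S \<Longrightarrow> mat_holomorphic_on (\<lambda>x. M x - N x) S"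
  by (auto simp: mat_holomorphic_on_def intro!: holomorphic_intros)

lemma mat_holomorphic_on_mat:
  "f holomorphic_on S \<Longrightarrow> mat_holomorphic_on (\<lambda>x. mat (f x)) S"
  unfolding mat_holomorphic_on_def mat2_mat_nth
  by (intro allI, case_tac "i = j") simp_all

lemma mat_holomorphic_on_deriv:
  "mat_holomorphic_on M S \<Longrightarrow> open S \<Longrightarrow> mat_holomorphic_on (mat_deriv M) S"
  by (auto simp: mat_holomorphic_on_def mat_deriv_nth intro!: holomorphic_deriv)

lemma mat_holomorphic_on_inv:
  assumes "mat_holomorphic_on M S" "\<And>x. x \<in> S \<Longrightarrow> det (M x) \<noteq> 0"
  shows "mat_holomorphic_on (\<lambda>x. matrix_inv (M x)) S"
proof -
  have M: "(\<lambda>x. M x $ i $ j) holomorphic_on S" for i j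
    using assms(1) by (simp add: mat_holomorphic_on_def)
  have det: "(\<lambda>x. det (M x)) holomorphic_on S"
    unfolding det_2 by (intro holomorphic_intros M)
  have quot: "(\<lambda>x. m x / det (M x)) holomorphic_on S" if "m holomorphic_on S" for m
    using that assms(2) det by (intro holomorphic_intros)
  have i11: "(\<lambda>x. matrix_inv (M x) $ 1 $ 1) holomorphic_on S"
    by (rule holomorphic_transform[OF quot[of "\<lambda>x. M x $ 2 $ 2"]])
      (use assms(2) in \<open>auto simp: matrix_inv_nth intro!: holomorphic_intros M\<close>)
  have i12: "(\<lambda>x. matrix_inv (M x) $ 1 $ 2) holomorphic_on S"
    by (rule holomorphic_transform[OF quot[of "\<lambda>x. - M x $ 1 $ 2"]])
      (use assms(2) in \<open>auto simp: matrix_inv_nth intro!: holomorphic_intros M\<close>)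
  have i21: "(\<lambda>x. matrix_inv (M x) $ 2 $ 1) holomorphic_on S"
    by (rule holomorphic_transform[OF quot[of "\<lambda>x. - M x $ 2 $ 1"]])
      (use assms(2) in \<open>auto simp: matrix_inv_nth intro!: holomorphic_intros M\<close>)
  have i22: "(\<lambda>x. matrix_inv (M x) $ 2 $ 2) holomorphic_on S"
    by (rule holomorphic_transform[OF quot[of "\<lambda>x. M x $ 1 $ 1"]])
      (use assms(2) in \<open>auto simp: matrix_inv_nth intro!: holomorphic_intros M\<close>)
  show ?thesis
    unfolding mat_holomorphic_on_def forall_2 using i11 i12 i21 i22 by blast
qed

section \<open>Effective divisors and their equations\<close>

lemma pt_chart_at [simp]: "pt (chart_at p) (coord_at p) = p"
  by (cases p) auto

lemma inj_pt: "inj (pt c)"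
  by (cases c) (auto simp: inj_on_def split: if_splits)

lemma local_factor_eq_0_iff: "local_factor c p x = 0 \<longleftrightarrow> pt c x = p"
  by (cases c; cases p) (auto simp: field_simps)

lemma local_eq_eq_0_iff: "local_eq D c x = 0 \<longleftrightarrow> pt c x \<in># D"
  by (auto simp: local_eq_def prod_mset_zero_iff local_factor_eq_0_iff)

lemma local_eq_union: "local_eq (D + E) c x = local_eq D c x * local_eq E c x"
  by (simp add: local_eq_def)

lemma local_factor_eq:
  assumes "pt c x0 = p"
  shows "local_factor c p = (\<lambda>x. x - x0)"
  using assms by (cases c; cases p) (auto simp: fun_eq_iff split: if_splits)

lemma local_factor_holomorphic: "local_factor c p holomorphic_on S"
proof (cases "\<exists>x0. pt c x0 = p")
  case True
  then show ?thesis
    using local_factor_eq by (auto intro!: holomorphic_intros)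
next
  case False
  \<comment> \<open>The first chart misses only \<open>Infty\<close> and the second one only \<open>Pt 0\<close>; the coordinates of all other
    points contradict the assumption.\<close>
  then have "local_factor c p = (\<lambda>x. 1)"
    using False[unfolded not_ex, rule_format, of "1 / (case p of Pt t \<Rightarrow> t)"]
      False[unfolded not_ex, rule_format, of "coord_at p"]
    by (cases c; cases p) (auto simp: fun_eq_iff split: if_splits)
  then show ?thesis
    by simp
qed

lemma local_eq_holomorphic: "local_eq D c holomorphic_on S"
proof (induction D)
  case empty
  then show ?case by (simp add: local_eq_def[abs_def])
next
  case (add p D)
  have "local_eq (add_mset p D) c = (\<lambda>x. local_factor c p x * local_eq D c x)"
    by (simp add: local_eq_def[abs_def])
  then show ?case
    using add local_factor_holomorphic by (auto intro!: holomorphic_intros)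
qed

lemma eventually_pt_notin: "\<forall>\<^sub>F y in at x. pt c y \<notin># P"
proof -
  have "finite (pt c -` set_mset P)"
    by (simp add: finite_vimageI inj_pt)
  then have "open (- (pt c -` set_mset P - {x}))"
    by (intro open_Compl finite_imp_closed) simp
  then have "\<forall>\<^sub>F y in at x. y \<in> - (pt c -` set_mset P - {x}) - {x}"
    by (rule eventually_at_in_open) auto
  then show ?thesis
    by (rule eventually_mono) auto
qed

text \<open>
  Analytic functions are determined by their values on a punctured neighbourhood. This removes the
  exceptional points from identities that can only be computed outside a divisor.
\<close>

lemma analytic_eq_at:
  assumes "f analytic_on {x}" "g analytic_on {x}" "\<forall>\<^sub>F y in at x. f y = g y"
  shows "f x = g x"
  using remove_sings_cong[OF assms(3) refl] assms(1,2) by simp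

lemma entire_eqI:
  assumes "f holomorphic_on UNIV" "g holomorphic_on UNIV"
    and "\<And>y. pt c y \<notin># P \<Longrightarrow> f y = g y"
  shows "f = g"
proof (rule ext)
  fix x
  show "f x = g x"
  proof (rule analytic_eq_at[of f x g])
    show "\<forall>\<^sub>F y in at x. f y = g y"
      using eventually_pt_notin[of c P x] assms(3) by (auto elim: eventually_mono)
  qed (use assms(1,2) in \<open>simp_all add: analytic_on_holomorphic\<close>, blast+)
qed

text \<open>
  The points of a reduced divisor are simple zeros of its equation, so an entire function that
  vanishes there can be divided by the linear factors one after the other; multiplicity one guarantees
  that the quotient still vanishes at the points that are left.
\<close>

lemma entire_divisible_by_local_eq:
  assumes "f holomorphic_on UNIV" "\<And>x. pt c x \<in># Q \<Longrightarrow> f x = 0" "\<forall>p. count Q p \<le> 1"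
  shows "\<exists>u. u holomorphic_on UNIV \<and> (\<forall>x. f x = local_eq Q c x * u x)"
  using assms
proof (induction Q arbitrary: f)
  case empty
  then show ?case by (auto simp: local_eq_def)
next
  case (add q Q)
  have count: "count Q p \<le> 1" for p
    using add.prems(3)[rule_format, of p] by (simp split: if_splits)
  have notin: "q \<notin># Q"
    using add.prems(3)[rule_format, of q] by (simp add: not_in_iff)
  obtain f1 where f1: "f1 holomorphic_on UNIV" "\<And>x. f x = local_factor c q x * f1 x"
  proof (cases "\<exists>x0. pt c x0 = q")
    case True
    then obtain x0 where x0: "pt c x0 = q" by blast
    have "f x0 = 0"
      using add.prems(2) x0 by simp
    let ?f1 = "\<lambda>z. if z = x0 then deriv f x0 else (f z - f x0) / (z - x0)"
    have "?f1 holomorphic_on UNIV"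
      using add.prems(1) by (intro pole_lemma_open) auto
    moreover have "f x = local_factor c q x * ?f1 x" for x
      using \<open>f x0 = 0\<close> by (simp add: local_factor_eq[OF x0])
    ultimately show ?thesis
      using that by blast
  next
    case False
    let ?f1 = "\<lambda>x. f x / local_factor c q x"
    have "local_factor c q x \<noteq> 0" for x
      using False by (simp add: local_factor_eq_0_iff)
    then show ?thesis
      using add.prems(1) by (intro that[of ?f1]) (auto intro!: holomorphic_intros local_factor_holomorphic)
  qed
  have "\<exists>u. u holomorphic_on UNIV \<and> (\<forall>x. f1 x = local_eq Q c x * u x)"
  proof (rule add.IH)
    show "f1 x = 0" if "pt c x \<in># Q" for x
    proof -
      have "f x = 0" using add.prems(2) that by simp
      moreover have "local_factor c q x \<noteq> 0"
        using that notin by (auto simp: local_factor_eq_0_iff)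
      ultimately show ?thesis
        using f1(2) by simp
    qed
  qed (use f1 count in auto)
  then show ?case
    using f1(2) by (auto simp: local_eq_def mult.assoc)
qed

lemma local_eq_split:
  "\<exists>E. p \<notin># E \<and> (\<forall>x. local_eq D (chart_at p) x = (x - coord_at p) ^ count D p * local_eq E (chart_at p) x)"
proof (intro exI[of _ "filter_mset (\<lambda>q. q \<noteq> p) D"] conjI allI)
  have D: "D = filter_mset (\<lambda>q. q = p) D + filter_mset (\<lambda>q. q \<noteq> p) D"
    by (rule multiset_partition)
  fix x
  show "local_eq D (chart_at p) x =
      (x - coord_at p) ^ count D p * local_eq (filter_mset (\<lambda>q. q \<noteq> p) D) (chart_at p) x"
    by (subst D, subst local_eq_union)
      (simp add: local_eq_def filter_eq_replicate_mset local_factor_eq[OF pt_chart_at])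
qed auto

section \<open>Push-forward of connections\<close>

lemma push_forward_outside:
  assumes "pt c x \<notin># P" "det (h c x) \<noteq> 0"
  shows "push_forward P h A c x ** h c x = h c x ** A c x - mat_deriv (h c) x"
  using assms by (simp add: push_forward_def matrix_inv_mult flip: matrix_mul_assoc)

text \<open>
  All transformations that occur below are of this form: \<open>id \<oplus> \<phi>\<close> has \<open>a = 1\<close>, \<open>f = 0\<close>, \<open>b = \<phi>\<close>, and
  automorphisms of the target bundle have constant \<open>b\<close>. The constancy of \<open>a\<close> is what keeps the first
  row free of derivatives.
\<close>

lemma push_forward_lower_triangular:
  assumes h: "\<And>x. h c x = lower_triangular a (f x) (b x)" and "pt c x \<notin># P" "a \<noteq> 0" "b x \<noteq> 0"
  shows "push_forward P h A c x $ 1 $ 1 = A c x $ 1 $ 1 - A c x $ 1 $ 2 * f x / b x"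
    and "push_forward P h A c x $ 1 $ 2 = a * A c x $ 1 $ 2 / b x"
    and "push_forward P h A c x $ 2 $ 1 = (f x * A c x $ 1 $ 1 + b x * A c x $ 2 $ 1 - deriv f x) / a
           - (f x * A c x $ 1 $ 2 + b x * A c x $ 2 $ 2 - deriv b x) * f x / (a * b x)"
    and "push_forward P h A c x $ 2 $ 2 = f x * A c x $ 1 $ 2 / b x + A c x $ 2 $ 2 - deriv b x / b x"
proof -
  have "h c = (\<lambda>x. lower_triangular a (f x) (b x))"
    using h by auto
  with assms(2-) show 
    "push_forward P h A c x $ 1 $ 1 = A c x $ 1 $ 1 - A c x $ 1 $ 2 * f x / b x"
    "push_forward P h A c x $ 1 $ 2 = a * A c x $ 1 $ 2 / b x"
    "push_forward P h A c x $ 2 $ 1 = (f x * A c x $ 1 $ 1 + b x * A c x $ 2 $ 1 - deriv f x) / a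
           - (f x * A c x $ 1 $ 2 + b x * A c x $ 2 $ 2 - deriv b x) * f x / (a * b x)"
    "push_forward P h A c x $ 2 $ 2 = f x * A c x $ 1 $ 2 / b x + A c x $ 2 $ 2 - deriv b x / b x"
    by (simp_all add: push_forward_def mat2_mult_nth matrix_inv_nth mat_deriv_lower_triangular field_simps)
qed

text \<open>
  The compatibility of the two connection matrices on the overlap of the charts. As a condition at a
  single point it also applies to transformations that degenerate elsewhere.
\<close>

definition gluing_at :: "clutching \<Rightarrow> connection_matrix \<Rightarrow> complex \<Rightarrow> bool" where
  "gluing_at g A z \<longleftrightarrow>
     g z ** (mat (- 1 / z\<^sup>2) ** A U1 (1 / z)) = A U0 z ** g z + mat_deriv g z"

lemma is_connection_gluing:
  "is_connection D g A \<Longrightarrow> z \<noteq> 0 \<Longrightarrow> Pt z \<notin># D \<Longrightarrow> gluing_at g A z"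
  by (simp add: is_connection_def gluing_at_def)

text \<open>
  Differentiating the compatibility \<open>h\<^sub>0 g = g' h\<^sub>1\<close> of \<open>h\<close> with the clutching matrices produces exactly
  the terms by which the two local push-forward formulas differ. The equation is checked
  after multiplication by the invertible matrix \<open>h\<^sub>1\<close> on the right.
\<close>

lemma gluing_at_push_forward:
  assumes glue: "gluing_at g A z" and g: "is_bundle g" and g': "is_bundle g'"
    and h: "bundle_hom g g' h" and z: "z \<noteq> 0" "Pt z \<notin># P"
    and det: "det (h U0 z) \<noteq> 0" "det (h U1 (1 / z)) \<noteq> 0"
  shows "gluing_at g' (push_forward P h A) z"
proof -
  let ?A' = "push_forward P h A" and ?k = "mat (- 1 / z\<^sup>2) :: mat2"
  have k: "?k ** M = M ** ?k" for M :: mat2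
    by (simp add: mat2_eq_iff mat2_mult_nth mat2_mat_nth)
  have h_diff: "(\<lambda>y. h c y $ i $ j) field_differentiable at x" for c x i j
    using h mat_holomorphic_on_differentiable[of "h c" UNIV] by (auto simp: bundle_hom_def)
  have g_diff: "(\<lambda>y. g y $ i $ j) field_differentiable at z"
    and g'_diff: "(\<lambda>y. g' y $ i $ j) field_differentiable at z" for i j
    using g g' z(1) mat_holomorphic_on_differentiable[of _ "- {0}" z]
    by (auto simp: is_bundle_def)
  have hinv_diff: "(\<lambda>y. h U1 (1 / y) $ i $ j) field_differentiable at z" for i j
  proof -
    have "(\<lambda>y. 1 / y) field_differentiable at z"
      using z(1) by (auto intro!: derivative_intros)
    then show ?thesis
      using field_differentiable_compose[of "\<lambda>y. 1 / y" z "\<lambda>y. h U1 y $ i $ j"] h_diff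
      by (simp add: o_def)
  qed
  \<comment> \<open>The derivative of the relation that makes \<open>h\<close> a bundle morphism.\<close>
  have "mat_deriv (\<lambda>y. h U0 y ** g y) z = mat_deriv (\<lambda>y. g' y ** h U1 (1 / y)) z"
  proof -
    have "\<forall>\<^sub>F y in nhds z. h U0 y ** g y = g' y ** h U1 (1 / y)"
      using h z(1) t1_space_nhds[of z 0]
      by (auto simp: bundle_hom_def elim!: eventually_mono)
    then have "deriv (\<lambda>y. (h U0 y ** g y) $ i $ j) z = deriv (\<lambda>y. (g' y ** h U1 (1 / y)) $ i $ j) z" for i j
      by (intro deriv_cong_ev) (auto elim!: eventually_mono)
    then show ?thesis
      by (simp add: mat_deriv_def)
  qed
  then have deriv_eq: "mat_deriv (h U0) z ** g z + h U0 z ** mat_deriv g z =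
      mat_deriv g' z ** h U1 (1 / z) + g' z ** (?k ** mat_deriv (h U1) (1 / z))"
    using z(1) by (simp add: mat_deriv_mult h_diff g_diff g'_diff hinv_diff mat_deriv_inverse)
  have comm: "h U0 z ** g z = g' z ** h U1 (1 / z)"
    using h z(1) by (simp add: bundle_hom_def)
  have A0: "?A' U0 z ** h U0 z = h U0 z ** A U0 z - mat_deriv (h U0) z"
    using z det by (intro push_forward_outside) auto
  have A1: "?A' U1 (1 / z) ** h U1 (1 / z) = h U1 (1 / z) ** A U1 (1 / z) - mat_deriv (h U1) (1 / z)"
    using z det by (intro push_forward_outside) auto
  have "g' z ** (?k ** ?A' U1 (1 / z)) ** h U1 (1 / z) =
      g' z ** (?k ** (h U1 (1 / z) ** A U1 (1 / z) - mat_deriv (h U1) (1 / z)))"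
    by (simp add: matrix_mul_assoc flip: A1)
  also have "\<dots> = g' z ** h U1 (1 / z) ** (?k ** A U1 (1 / z)) - g' z ** (?k ** mat_deriv (h U1) (1 / z))"
    by (simp add: mat2_eq_iff mat2_mult_nth mat2_mat_nth algebra_simps)
  also have "g' z ** h U1 (1 / z) ** (?k ** A U1 (1 / z)) = h U0 z ** (A U0 z ** g z + mat_deriv g z)"
    using glue unfolding gluing_at_def by (simp flip: comm matrix_mul_assoc)
  also have "\<dots> - g' z ** (?k ** mat_deriv (h U1) (1 / z)) =
      (h U0 z ** A U0 z - mat_deriv (h U0) z) ** g z + mat_deriv g' z ** h U1 (1 / z)"
    using deriv_eq by (simp add: matrix_add_ldistrib mat2_diff_rdistrib matrix_mul_assoc algebra_simps)
  also have "\<dots> = (?A' U0 z ** g' z + mat_deriv g' z) ** h U1 (1 / z)"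
    by (simp add: mat2_add_rdistrib comm flip: A0 matrix_mul_assoc)
  finally show ?thesis
    unfolding gluing_at_def using mat2_mult_right_cancel[OF det(2)] by blast
qed

text \<open>
  If \<open>A = B / d\<close> and \<open>h\<close> is invertible everywhere, then \<open>(h B - d h') h\<^sup>-\<^sup>1\<close> is an entire numerator of the
  new connection matrix: an isomorphism creates no poles.
\<close>

lemma is_connection_push_forward_iso:
  assumes A: "is_connection P g A" and g: "is_bundle g" and g': "is_bundle g'"
    and h: "bundle_iso g g' h"
  shows "is_connection P g' (push_forward P h A)"
  unfolding is_connection_def
proof (intro conjI allI impI)
  have hom: "bundle_hom g g' h" and det: "\<And>c x. det (h c x) \<noteq> 0"
    using h by (auto simp: bundle_iso_def)
  fix c
  obtain B where B: "mat_holomorphic_on B UNIV" "\<And>x i j. A c x $ i $ j = B x $ i $ j / local_eq P c x"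
    using A unfolding is_connection_def by blast
  have h_hol: "mat_holomorphic_on (h c) UNIV"
    using hom by (simp add: bundle_hom_def)
  let ?B' = "\<lambda>x. (h c x ** B x - mat (local_eq P c x) ** mat_deriv (h c) x) ** matrix_inv (h c x)"
  show "\<exists>B'. mat_holomorphic_on B' UNIV \<and>
      (\<forall>x i j. push_forward P h A c x $ i $ j = B' x $ i $ j / local_eq P c x)"
  proof (intro exI[of _ ?B'] conjI allI)
    show "mat_holomorphic_on ?B' UNIV"
      by (intro mat_holomorphic_on_mult mat_holomorphic_on_diff mat_holomorphic_on_mat
          mat_holomorphic_on_deriv mat_holomorphic_on_inv h_hol B(1) local_eq_holomorphic det) auto
    show "push_forward P h A c x $ i $ j = ?B' x $ i $ j / local_eq P c x" for x i j
      using exhaust_2[of i]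
      by (cases "pt c x \<in># P")
        (auto simp: push_forward_def local_eq_eq_0_iff mat2_mult_nth mat2_mat_nth B(2) field_simps)
  qed
next
  fix z assume z: "z \<noteq> 0 \<and> Pt z \<notin># P"
  have "gluing_at g' (push_forward P h A) z"
    using z h by (intro gluing_at_push_forward[OF is_connection_gluing[OF A]] g g')
      (auto simp: bundle_iso_def)
  then show "g' z ** (mat (- 1 / z\<^sup>2) ** push_forward P h A U1 (1 / z)) =
      push_forward P h A U0 z ** g' z + mat_deriv g' z"
    by (simp add: gluing_at_def)
qed

section \<open>Forms on the projective line and bundle automorphisms\<close>

text \<open>
  A pair of entire functions that agree on the overlap is bounded at infinity, hence constant by
  Liouville's theorem.
\<close>

lemma local_function_constant:
  assumes "f0 holomorphic_on UNIV" "f1 holomorphic_on UNIV" "\<And>z. z \<noteq> 0 \<Longrightarrow> f0 z = f1 (1 / z)"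
  obtains a where "\<And>z. f0 z = a" "\<And>z. f1 z = a"
proof (rule that)
  have "f1 \<midarrow>0\<rightarrow> f1 0"
    using holomorphic_on_imp_continuous_on[OF assms(2)]
    by (simp add: continuous_on_eq_continuous_at isContD)
  moreover have "filterlim (\<lambda>z :: complex. 1 / z) (at 0) at_infinity"
    using tendsto_inverse_0[where ?'a = complex]
    by (intro filterlim_atI)
      (auto simp: inverse_eq_divide[abs_def] eventually_at_infinity intro!: exI[of _ 1])
  ultimately have "((\<lambda>z. f1 (1 / z)) \<longlongrightarrow> f1 0) at_infinity"
    by (rule filterlim_compose)
  moreover have "\<forall>\<^sub>F z in at_infinity. f1 (1 / z) = f0 z"
    by (auto simp: eventually_at_infinity intro!: exI[of _ 1] assms(3)[symmetric])
  ultimately have "(f0 \<longlongrightarrow> f1 0) at_infinity"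
    by (rule Lim_transform_eventually)
  then have f0: "f0 z = f1 0" for z
    using assms(1) Liouville_weak by blast
  then show "f0 z = f1 0" for z .
  show "f1 z = f1 0" for z
    using f0[of "1 / z"] assms(3)[of "1 / z"] by (cases "z = 0") auto
qed

lemma Omega_bundle_holomorphic: "Omega_bundle D holomorphic_on - {0}"
proof -
  have "(\<lambda>z. E_target D z $ 2 $ 2) holomorphic_on - {0}"
    using is_bundle_O_Omega[of D] unfolding is_bundle_def mat_holomorphic_on_def by blast
  then show ?thesis
    by (simp add: direct_sum_def)
qed

lemma Omega_bundle_nonzero: "z \<noteq> 0 \<Longrightarrow> Omega_bundle D z \<noteq> 0"
  using is_bundle_O_Omega[of D] by (auto simp: is_bundle_def direct_sum_def det_2)

text \<open>
  Up to a constant factor, the bundle of forms with poles in \<open>D\<close> is \<open>\<O>(deg D - 2)\<close>.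
\<close>

lemma Omega_bundle_monomial:
  assumes "size D \<ge> 2"
  obtains K where "K \<noteq> 0" "\<And>z. z \<noteq> 0 \<Longrightarrow> Omega_bundle D z = K * z ^ (size D - 2)"
proof -
  have "\<exists>K. K \<noteq> 0 \<and> (\<forall>z. (\<Prod>p\<in>#D. local_ratio p z) = K * z ^ size D)" for D
  proof (induction D)
    case empty
    then show ?case by (auto intro!: exI[of _ 1])
  next
    case (add p D)
    then obtain K where K: "K \<noteq> 0" "\<And>z. (\<Prod>p\<in>#D. local_ratio p z) = K * z ^ size D"
      by blast
    obtain k where k: "k \<noteq> 0" "\<And>z. local_ratio p z = k * z"
      using local_ratio.simps by (cases p) (metis mult_1 zero_neq_one neg_equal_0_iff_equal)+
    show ?case
      using K k by (intro exI[of _ "k * K"]) simp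
  qed
  then obtain K where K: "K \<noteq> 0" "\<And>z. (\<Prod>p\<in>#D. local_ratio p z) = K * z ^ size D"
    by blast
  show ?thesis
  proof (rule that[of "- K"])
    show "- K \<noteq> 0" using K by simp
    show "Omega_bundle D z = - K * z ^ (size D - 2)" if "z \<noteq> 0" for z
      using assms that by (simp add: Omega_bundle_def K(2) power_diff power2_eq_square)
  qed
qed

text \<open>
  Clearing denominators turns a form with poles in \<open>D\<close> and values in the dual of a line bundle \<open>L\<close>
  into a morphism \<open>L \<rightarrow> \<Omega>\<^sup>1(D)\<close>; here \<open>a\<close> is the clutching function of \<open>L\<close>. The factor \<open>- 1 / z\<^sup>2\<close> comes from \<open>dw = - dz / z\<^sup>2\<close>. The compatibility is computed
  outside \<open>D\<close> and extends by continuity.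
\<close>

lemma Omega_numerator_gluing:
  assumes hol: "\<And>c. f c holomorphic_on UNIV" and a: "a holomorphic_on - {0}"
    and glue: "\<And>z. z \<noteq> 0 \<Longrightarrow> Pt z \<notin># D \<Longrightarrow>
       f U0 z / local_eq D U0 z * a z = - (f U1 (1 / z) / local_eq D U1 (1 / z)) / z\<^sup>2"
    and z: "z \<noteq> 0"
  shows "a z * f U0 z = Omega_bundle D z * f U1 (1 / z)"
proof -
  have off: "a y * f U0 y = Omega_bundle D y * f U1 (1 / y)" if "y \<noteq> 0" "Pt y \<notin># D" for y
  proof -
    have nz: "local_eq D U0 y \<noteq> 0"
      using that by (simp add: local_eq_eq_0_iff)
    with that(1) have nz': "local_eq D U1 (1 / y) \<noteq> 0"
      using local_eq_ratio[of y D] by auto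
    have "a y * f U0 y = (f U0 y / local_eq D U0 y * a y) * local_eq D U0 y"
      using nz by simp
    also have "\<dots> = - (f U1 (1 / y) / local_eq D U1 (1 / y)) / y\<^sup>2 * local_eq D U0 y"
      using glue[OF that] by simp
    also have "\<dots> = Omega_bundle D y * f U1 (1 / y)"
      using nz' that(1) by (simp add: local_eq_ratio[of y D] Omega_bundle_def)
    finally show ?thesis .
  qed
  have an0: "f U0 analytic_on {z}" and a_an: "a analytic_on {z}" and Om: "Omega_bundle D analytic_on {z}"
    using holomorphic_on_subset[OF hol[of U0]] a Omega_bundle_holomorphic z
    by (auto simp: analytic_at intro!: exI[of _ "- {0}"])
  have "(\<lambda>y. f U1 (1 / y)) holomorphic_on - {0}"
    using hol[of U1]
    by (intro holomorphic_on_compose_gen[of "\<lambda>y. 1 / y" "- {0}" "f U1" UNIV, unfolded o_def])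
      (auto intro!: holomorphic_intros)
  then have an1: "(\<lambda>y. f U1 (1 / y)) analytic_on {z}"
    using z by (auto simp: analytic_at intro!: exI[of _ "- {0}"])
  show ?thesis
  proof (rule analytic_eq_at[of "\<lambda>z. a z * f U0 z" z "\<lambda>z. Omega_bundle D z * f U1 (1 / z)"])
    have "\<forall>\<^sub>F y in at z. pt U0 y \<notin># D" "\<forall>\<^sub>F y in at z. y \<noteq> 0"
      using eventually_pt_notin[of U0 D z] z t1_space_nhds[of z 0] by (auto simp: eventually_at_filter elim: eventually_mono)
    then show "\<forall>\<^sub>F y in at z. a y * f U0 y = Omega_bundle D y * f U1 (1 / y)"
      by eventually_elim (use off in auto)
  qed (intro analytic_intros an0 an1 a_an Om)+
qed

text \<open>
  The diagonal entries are global functions, hence constant. The entry \<open>(1,2)\<close> is a morphism from a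
  bundle of positive degree \<open>n - 2\<close> to the trivial bundle: in the first chart, its multiple by \<open>z ^ (n - 2)\<close> is a
  global function that vanishes at \<open>0\<close>, so it is zero.
\<close>

lemma endomorphism_O_Omega:
  assumes "size D \<ge> 3" and h: "bundle_hom (E_target D) (E_target D) h"
  shows "\<exists>a b f. (\<forall>c. f c holomorphic_on UNIV) \<and> (\<forall>c x. h c x = lower_triangular a (f c x) b)"
proof -
  obtain K where K: "K \<noteq> 0" "\<And>z. z \<noteq> 0 \<Longrightarrow> Omega_bundle D z = K * z ^ (size D - 2)"
    using Omega_bundle_monomial assms(1) by (metis Suc_leD numeral_2_eq_2 numeral_3_eq_3)
  have hol: "(\<lambda>x. h c x $ i $ j) holomorphic_on UNIV" for c i j
    using h by (simp add: bundle_hom_def mat_holomorphic_on_def)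
  have "h U0 z ** E_target D z = E_target D z ** h U1 (1 / z)" if "z \<noteq> 0" for z
    using h that by (simp add: bundle_hom_def)
  then have glue: "h U0 z $ 1 $ 1 = h U1 (1 / z) $ 1 $ 1"
    "h U0 z $ 1 $ 2 * Omega_bundle D z = h U1 (1 / z) $ 1 $ 2"
    "h U0 z $ 2 $ 2 * Omega_bundle D z = Omega_bundle D z * h U1 (1 / z) $ 2 $ 2" if "z \<noteq> 0" for z
    using that by (simp_all add: mat2_eq_iff mat2_mult_nth direct_sum_def O_bundle_def)
  have glue12: "K * z ^ (size D - 2) * h U0 z $ 1 $ 2 = h U1 (1 / z) $ 1 $ 2" if "z \<noteq> 0" for z
    using glue(2)[OF that] unfolding K(2)[OF that] by (simp only: mult.commute)
  have glue22: "h U0 z $ 2 $ 2 = h U1 (1 / z) $ 2 $ 2" if "z \<noteq> 0" for z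
    using glue(3)[OF that] Omega_bundle_nonzero[OF that, of D] by (metis mult.commute mult_cancel_left)
  have "\<exists>a. \<forall>c x. h c x $ i $ i = a" if eq: "\<And>z. z \<noteq> 0 \<Longrightarrow> h U0 z $ i $ i = h U1 (1 / z) $ i $ i" for i
  proof -
    obtain a where "\<And>z. h U0 z $ i $ i = a" "\<And>z. h U1 z $ i $ i = a"
      using local_function_constant[OF hol[of U0 i i] hol[of U1 i i] eq] by blast
    then have "h c x $ i $ i = a" for c x
      by (cases c) simp_all
    then show ?thesis
      by blast
  qed
  from this[of 1, OF glue(1)] this[of 2, OF glue22]
  obtain a b where ab: "\<And>c x. h c x $ 1 $ 1 = a" "\<And>c x. h c x $ 2 $ 2 = b"
    by blast
  have "h c x $ 1 $ 2 = 0" for c x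
  proof -
    have hol': "(\<lambda>z. K * z ^ (size D - 2) * h U0 z $ 1 $ 2) holomorphic_on UNIV"
      by (intro holomorphic_intros hol)
    obtain k where k: "\<And>z. K * z ^ (size D - 2) * h U0 z $ 1 $ 2 = k" "\<And>z. h U1 z $ 1 $ 2 = k"
      using local_function_constant[OF hol' hol[of U1 1 2] glue12] by blast
    have "k = 0"
      using k(1)[of 0] assms(1) by (simp add: power_0_left)
    then have "h U0 z $ 1 $ 2 = 0" if "pt U0 z \<notin># {#Pt 0#}" for z
      using k(1)[of z] K(1) that by simp
    then have "(\<lambda>z. h U0 z $ 1 $ 2) = (\<lambda>z. 0)"
      by (intro entire_eqI[OF hol, of _ U0 "{#Pt 0#}"]) auto
    with k(2) \<open>k = 0\<close> show ?thesis
      by (cases c) (auto dest: fun_cong)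
  qed
  then have "h c x = lower_triangular a (h c x $ 2 $ 1) b" for c x
    by (simp add: mat2_eq_iff ab)
  then show ?thesis
    using hol[of _ 2 1]
    by (intro exI[of _ a] exI[of _ b] exI[of _ "\<lambda>c x. h c x $ 2 $ 1"]) simp
qed

section \<open>The divisor of zeros of a section\<close>

lemma deriv_nonzero_of_zorder_1:
  assumes "f holomorphic_on UNIV" "f w \<noteq> 0" "zorder f x = 1"
  shows "deriv f x \<noteq> 0"
proof -
  have "\<exists>w\<in>UNIV. f w \<noteq> 0"
    using assms(2) by blast
  from zorder_exist_zero[OF assms(1) open_UNIV connected_UNIV UNIV_I this, of x]
  obtain r where r: "r > 0" "zor_poly f x holomorphic_on cball x r"
    "\<And>w. w \<in> cball x r \<Longrightarrow> f w = zor_poly f x w * (w - x) \<and> zor_poly f x w \<noteq> 0"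
    unfolding assms(3) by auto
  then have nz: "zor_poly f x x \<noteq> 0"
    by simp
  let ?g = "zor_poly f x"
  have "?g holomorphic_on ball x r"
    using r(2) ball_subset_cball holomorphic_on_subset by blast
  then have "(?g has_field_derivative deriv ?g x) (at x)"
    using r(1) by (auto intro!: holomorphic_derivI)
  then have "((\<lambda>w. ?g w * (w - x)) has_field_derivative ?g x) (at x)"
    by (auto intro!: derivative_eq_intros)
  moreover have "\<forall>\<^sub>F w in nhds x. f w = ?g w * (w - x)"
    using eventually_nhds_in_open[of "ball x r" x] r by (auto elim!: eventually_mono)
  ultimately have "(f has_field_derivative ?g x) (at x)"
    using DERIV_cong_ev by fast
  then show ?thesis
    using nz DERIV_imp_deriv by fastforce
qed

text \<open>
  The multiplicities of the divisor of a nonzero morphism, from the line bundle with clutching function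
  \<open>u\<close> to the one with clutching function \<open>v\<close>, are defined through the preferred chart at each
  point; the lemmas below give the information in both charts.
\<close>

locale section_of_line_bundle =
  fixes \<phi> :: "chart \<Rightarrow> complex \<Rightarrow> complex" and u v :: "complex \<Rightarrow> complex"
  assumes holomorphic: "\<phi> c holomorphic_on UNIV"
    and uv_holomorphic: "u holomorphic_on - {0}" "v holomorphic_on - {0}"
    and uv_nonzero: "z \<noteq> 0 \<Longrightarrow> u z \<noteq> 0" "z \<noteq> 0 \<Longrightarrow> v z \<noteq> 0"
    and glue: "z \<noteq> 0 \<Longrightarrow> u z * \<phi> U0 z = v z * \<phi> U1 (1 / z)"
    and nonzero: "\<exists>c x. \<phi> c x \<noteq> 0"
begin

lemma zero_U1_iff: "z \<noteq> 0 \<Longrightarrow> \<phi> U1 (1 / z) = 0 \<longleftrightarrow> \<phi> U0 z = 0"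
  using glue[of z] uv_nonzero[of z] by auto

lemma nonzero_on_chart: "\<exists>x. \<phi> c x \<noteq> 0"
proof (rule ccontr)
  assume none: "\<not> (\<exists>x. \<phi> c x \<noteq> 0)"
  have other: "\<phi> c' x = 0" if "x \<noteq> 0" for c' x
    using none zero_U1_iff[of x] zero_U1_iff[of "1 / x"] that by (cases c; cases c') auto
  \<comment> \<open>The divisor \<open>{#Pt 0#}\<close> marks the origin of the first coordinate as the exceptional point.\<close>
  have "\<phi> c' = (\<lambda>x. 0)" for c'
    by (rule entire_eqI[of _ _ U0 "{#Pt 0#}"]) (use holomorphic other in auto)
  then show False
    using nonzero by simp
qed

lemma zero_iff_chart_at: "\<phi> c x = 0 \<longleftrightarrow> \<phi> (chart_at (pt c x)) (coord_at (pt c x)) = 0"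
  using zero_U1_iff[of "1 / x"] by (cases c) auto

lemma zorder_cases: "if \<phi> c x = 0 then zorder (\<phi> c) x > 0 else zorder (\<phi> c) x = 0"
  using zorder_exist_zero[of "\<phi> c" UNIV x] holomorphic nonzero_on_chart[of c] connected_UNIV[where 'a = complex] by simp

text \<open>
  The projective line is covered by the two closed unit discs, and on each of them a nonzero entire
  function has finitely many zeros. Without finiteness no multiset has the required
  multiplicities, and the definite description in \<^const>\<open>divisor_of\<close> would be meaningless.
\<close>

lemma finite_zeros: "finite {p. \<phi> (chart_at p) (coord_at p) = 0}"
proof -
  have fin: "finite {x \<in> cball 0 1. \<phi> c x = 0}" for c
  proof (cases "\<phi> c constant_on UNIV")
    case True
    then have "\<phi> c x \<noteq> 0" for x
      using nonzero_on_chart[of c] by (metis constant_on_def UNIV_I)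
    then show ?thesis
      by simp
  next
    case False
    then show ?thesis
      by (intro holomorphic_compact_finite_zeros[of _ UNIV]) (auto simp: holomorphic)
  qed
  have "p \<in> insert Infty (pt U0 ` {x \<in> cball 0 1. \<phi> U0 x = 0} \<union> pt U1 ` {x \<in> cball 0 1. \<phi> U1 x = 0})"
    if "\<phi> (chart_at p) (coord_at p) = 0" for p
  proof (cases p)
    case (Pt z)
    show ?thesis
    proof (cases "norm z \<le> 1")
      case True
      then show ?thesis using Pt that by auto
    next
      case False
      then have "z \<noteq> 0" "norm (1 / z) \<le> 1"
        by (auto simp: norm_divide divide_simps)
      moreover have "\<phi> U1 (1 / z) = 0"
        using zero_U1_iff[of z] Pt that \<open>z \<noteq> 0\<close> by simp
      ultimately have "1 / z \<in> {x \<in> cball 0 1. \<phi> U1 x = 0}" "p = pt U1 (1 / z)"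
        using Pt by auto
      then show ?thesis by blast
    qed
  qed simp
  then have "{p. \<phi> (chart_at p) (coord_at p) = 0} \<subseteq>
      insert Infty (pt U0 ` {x \<in> cball 0 1. \<phi> U0 x = 0} \<union> pt U1 ` {x \<in> cball 0 1. \<phi> U1 x = 0})"
    by blast
  then show ?thesis
    by (rule finite_subset) (use fin in blast)
qed

lemma count_divisor_of: "int (count (divisor_of \<phi>) p) = zorder (\<phi> (chart_at p)) (coord_at p)"
proof -
  let ?ord = "\<lambda>p. zorder (\<phi> (chart_at p)) (coord_at p)"
  have pos_iff: "?ord p > 0 \<longleftrightarrow> \<phi> (chart_at p) (coord_at p) = 0" and nonneg: "?ord p \<ge> 0" for p
    using zorder_cases[of "chart_at p" "coord_at p"] by (auto split: if_splits)
  have "finite {p. 0 < nat (?ord p)}"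
    using finite_zeros pos_iff by simp
  then have "\<forall>p. int (count (Abs_multiset (\<lambda>p. nat (?ord p))) p) = ?ord p"
    using nonneg by simp
  then have "\<exists>!Q. \<forall>p. int (count Q p) = ?ord p"
    by (intro ex1I) (assumption, metis multiset_eqI of_nat_eq_iff)
  from theI'[OF this] show ?thesis
    unfolding divisor_of_def by blast
qed

lemma zero_iff_in_divisor: "\<phi> c x = 0 \<longleftrightarrow> pt c x \<in># divisor_of \<phi>"
proof -
  let ?p = "pt c x"
  have "\<phi> c x = 0 \<longleftrightarrow> zorder (\<phi> (chart_at ?p)) (coord_at ?p) > 0"
    using zorder_cases[of "chart_at ?p" "coord_at ?p"] zero_iff_chart_at[of c x]
    by (auto split: if_splits)
  also have "\<dots> \<longleftrightarrow> ?p \<in># divisor_of \<phi>"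
    by (simp flip: count_divisor_of)
  finally show ?thesis .
qed

text \<open>
  In the second chart, away from infinity, the multiplicity is still measured in the first chart. There
  one differentiates the gluing relation at the zero: all terms in which \<open>\<phi>\<close> itself remains
  undifferentiated vanish, so the two derivatives differ by a nonzero factor.
\<close>

lemma deriv_nonzero_at_simple_zero:
  assumes zero: "\<phi> c x = 0" and simple: "count (divisor_of \<phi>) (pt c x) \<le> 1"
  shows "deriv (\<phi> c) x \<noteq> 0"
proof -
  let ?p = "pt c x"
  have "count (divisor_of \<phi>) ?p > 0"
    using zero zero_iff_in_divisor by auto
  with simple have "count (divisor_of \<phi>) ?p = 1"
    by linarith
  then have "zorder (\<phi> (chart_at ?p)) (coord_at ?p) = 1"
    using count_divisor_of[of ?p] by simp
  then have deriv: "deriv (\<phi> (chart_at ?p)) (coord_at ?p) \<noteq> 0"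
    using nonzero_on_chart[of "chart_at ?p"] deriv_nonzero_of_zorder_1 holomorphic by blast
  show ?thesis
  proof (cases "c = U1 \<and> x \<noteq> 0")
    case False
    then show ?thesis
      using deriv by (cases c) auto
  next
    case True
    define z where "z = 1 / x"
    have c: "c = U1" and z: "z \<noteq> 0" and x: "x = 1 / z"
      using True by (auto simp: z_def)
    have deriv0: "deriv (\<phi> U0) z \<noteq> 0"
      using deriv c x z by simp
    have zero0: "\<phi> U0 z = 0"
      using zero zero_U1_iff[OF z] c x by simp
    have du: "(u has_field_derivative deriv u z) (at z)" and dv: "(v has_field_derivative deriv v z) (at z)"
      using uv_holomorphic z by (auto intro!: holomorphic_derivI[of _ "- {0}"])
    have d0: "(\<phi> U0 has_field_derivative deriv (\<phi> U0) z) (at z)"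
      and d1: "(\<phi> U1 has_field_derivative deriv (\<phi> U1) x) (at (1 / z))"
      using holomorphic x by (auto intro!: holomorphic_derivI[of _ UNIV])
    have "((\<lambda>y. 1 / y) has_field_derivative - 1 / z\<^sup>2) (at z)"
      using z by (auto intro!: derivative_eq_intros simp: power2_eq_square)
    from DERIV_mult[OF dv DERIV_chain2[OF d1 this]]
    have "((\<lambda>y. v y * \<phi> U1 (1 / y)) has_field_derivative
        v z * (deriv (\<phi> U1) x * (- 1 / z\<^sup>2))) (at z)"
      using zero c x by (simp add: algebra_simps)
    moreover have "\<forall>\<^sub>F y in nhds z. v y * \<phi> U1 (1 / y) = u y * \<phi> U0 y"
      using t1_space_nhds[OF z] by (rule eventually_mono) (simp add: glue)
    ultimately have "((\<lambda>y. u y * \<phi> U0 y) has_field_derivative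
        v z * (deriv (\<phi> U1) x * (- 1 / z\<^sup>2))) (at z)"
      using DERIV_cong_ev by fast
    moreover have "((\<lambda>y. u y * \<phi> U0 y) has_field_derivative u z * deriv (\<phi> U0) z) (at z)"
      using DERIV_mult[OF du d0] zero0 by (simp add: mult.commute)
    ultimately have "v z * (deriv (\<phi> U1) x * (- 1 / z\<^sup>2)) = u z * deriv (\<phi> U0) z"
      by (rule DERIV_unique)
    then show ?thesis
      using deriv0 uv_nonzero[OF z] c by auto
  qed
qed

end

section \<open>Residues\<close>

text \<open>
  At a simple zero of \<open>f\<close> the logarithmic derivative has residue \<open>1\<close>. The function is written as the
  single quotient \<open>(f k - f') / f\<close>, with a simple pole.
\<close>

lemma residue_log_derivative:
  assumes k: "k analytic_on {q}" and f: "f holomorphic_on UNIV" "f q = 0" "deriv f q \<noteq> 0"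
    and nz: "\<forall>\<^sub>F y in at q. f y \<noteq> 0"
    and g: "\<forall>\<^sub>F y in at q. g y = k y - deriv f y / f y"
  shows "residue g q = - 1"
proof -
  obtain r where r: "r > 0" "k holomorphic_on ball q r"
    using k by (auto simp: analytic_on_def)
  let ?n = "\<lambda>y. f y * k y - deriv f y"
  have fb: "f holomorphic_on ball q r"
    using f(1) holomorphic_on_subset by blast
  have "?n holomorphic_on ball q r"
    using r fb by (intro holomorphic_intros) auto
  moreover have "(f has_field_derivative deriv f q) (at q)"
    using f(1) by (auto intro!: holomorphic_derivI[of _ UNIV])
  ultimately have "residue (\<lambda>y. ?n y / f y) q = ?n q / deriv f q"
    using r f fb by (intro residue_simple_pole_deriv[of _ "ball q r"]) auto
  moreover have "residue g q = residue (\<lambda>y. ?n y / f y) q"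
  proof (rule residue_cong)
    show "\<forall>\<^sub>F y in at q. g y = ?n y / f y"
      using g nz
      by eventually_elim (simp add: field_simps)
  qed simp
  ultimately show ?thesis
    using f by simp
qed

lemma residue_analytic: "f analytic_on {x} \<Longrightarrow> residue f x = 0"
  using residue_holo by (auto simp: analytic_at)

lemma leading_polar_coefficient_nonzero:
  assumes "p \<in># D"
  shows "residue (\<lambda>y. (y - coord_at p) ^ (count D p - 1) * (1 / local_eq D (chart_at p) y)) (coord_at p) \<noteq> 0"
proof -
  let ?x = "coord_at p" and ?c = "chart_at p"
  obtain E where E: "p \<notin># E" "\<And>y. local_eq D ?c y = (y - ?x) ^ count D p * local_eq E ?c y"
    using local_eq_split by blast
  have Ex: "local_eq E ?c ?x \<noteq> 0"
    using E(1) by (simp add: local_eq_eq_0_iff)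
  let ?S = "- (pt ?c -` set_mset E)"
  have S: "open ?S" "?x \<in> ?S"
    using E(1) by (auto intro!: open_Compl finite_imp_closed finite_vimageI inj_pt)
  have "residue (\<lambda>y. (y - ?x) ^ (count D p - 1) * (1 / local_eq D ?c y)) ?x =
      residue (\<lambda>y. (1 / local_eq E ?c y) / (y - ?x)) ?x"
  proof (rule residue_cong)
    have "(y - ?x) ^ (count D p - 1) * (1 / local_eq D ?c y) = (1 / local_eq E ?c y) / (y - ?x)"
      if "y \<noteq> ?x" for y
    proof -
      have "(y - ?x) ^ count D p = (y - ?x) * (y - ?x) ^ (count D p - 1)"
        using assms by (simp flip: power_Suc)
      then show ?thesis
        using that by (simp add: E(2))
    qed
    then show "\<forall>\<^sub>F y in at ?x. (y - ?x) ^ (count D p - 1) * (1 / local_eq D ?c y) =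
        (1 / local_eq E ?c y) / (y - ?x)"
      by (auto simp: eventually_at_filter)
  qed simp
  also have "\<dots> = 1 / local_eq E ?c ?x"
    using S by (intro residue_simple[of ?S]) (auto intro!: holomorphic_intros local_eq_holomorphic simp: local_eq_eq_0_iff)
  finally show ?thesis
    using Ex by simp
qed

section \<open>The transformed connection and its normal form\<close>

lemma gluing_at_E_source_row1:
  assumes "gluing_at E_source A z" "z \<noteq> 0"
  shows "A U0 z $ 1 $ 1 = - A U1 (1 / z) $ 1 $ 1 / z\<^sup>2"
    and "A U0 z $ 1 $ 2 * z = - A U1 (1 / z) $ 1 $ 2 / z\<^sup>2"
  using assms
  by (simp_all add: gluing_at_def mat2_eq_iff mat2_mult_nth mat2_mat_nth mat_deriv_nth direct_sum_def O_bundle_def)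

text \<open>
  The function \<^const>\<open>cyclic_morphism\<close> is only sensitive to the connection outside a finite set, so the
  conventional value zero at the poles does no harm.
\<close>

lemma cyclic_morphism_eq:
  assumes "f holomorphic_on UNIV" "\<And>y. pt c y \<notin># P \<Longrightarrow> A c y $ 1 $ 2 = f y / local_eq D c y"
  shows "cyclic_morphism D A c = f"
proof
  fix x
  have "\<forall>\<^sub>F y in at x. local_eq D c y * A c y $ 1 $ 2 = f y"
    using eventually_pt_notin[of c P x] eventually_pt_notin[of c D x]
    by eventually_elim (simp add: assms(2) local_eq_eq_0_iff)
  then have "cyclic_morphism D A c x = remove_sings f x"
    unfolding cyclic_morphism_def by (rule remove_sings_cong) simp
  also have "\<dots> = f x"
    using assms(1) by (intro remove_sings_at_analytic) (auto simp: analytic_on_holomorphic)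
  finally show "cyclic_morphism D A c x = f x" .
qed

text \<open>
  The numerators \<open>B\<close> are part of the data because \<open>A\<close> itself has only the conventional value zero at
  the points of \<open>D\<close>, where holomorphy has to be expressed. The conditions on zeros say, chart by
  chart, that \<open>Q\<close> is the divisor of zeros of the cyclic morphism \<open>B\<^sub>1\<^sub>2\<close> and that it is reduced.
\<close>

locale cyclic_connection =
  fixes D Q :: "p1 multiset" and A :: connection_matrix and B :: "chart \<Rightarrow> complex \<Rightarrow> mat2"
  assumes size_D: "size D \<ge> 3"
    and B_holomorphic: "mat_holomorphic_on (B c) UNIV"
    and A_eq: "A c x $ i $ j = B c x $ i $ j / local_eq D c x"
    and gluing: "z \<noteq> 0 \<Longrightarrow> Pt z \<notin># D \<Longrightarrow> gluing_at E_source A z"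
    and reduced: "count Q p \<le> 1"
    and disjoint: "set_mset Q \<inter> set_mset D = {}"
    and zero_iff: "B c x $ 1 $ 2 = 0 \<longleftrightarrow> pt c x \<in># Q"
    and simple_zero: "pt c x \<in># Q \<Longrightarrow> deriv (\<lambda>x. B c x $ 1 $ 2) x \<noteq> 0"
begin

abbreviation "P \<equiv> D + Q"
abbreviation "\<phi> c x \<equiv> B c x $ 1 $ 2"
abbreviation "\<sigma> c x \<equiv> B c x $ 1 $ 1"

lemma entry_holomorphic: "(\<lambda>x. B c x $ i $ j) holomorphic_on S"
  using B_holomorphic[of c] holomorphic_on_subset[OF _ subset_UNIV] by (auto simp: mat_holomorphic_on_def)

lemma deriv_entry_holomorphic: "deriv (\<lambda>x. B c x $ i $ j) holomorphic_on S"
  using holomorphic_deriv[OF entry_holomorphic open_UNIV] holomorphic_on_subset by blast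

text \<open>
  The \<open>(1,2)\<close> entry of the connection is a form with values in the dual of \<open>\<O>(1)\<close>, and the \<open>(1,1)\<close>
  entry is an ordinary form because the first summand is trivial; both have poles in \<open>D\<close>. So \<open>\<phi>\<close> is
  a morphism \<open>\<O>(1) \<rightarrow> \<Omega>\<^sup>1(D)\<close> and \<open>\<sigma>\<close> is a section of \<open>\<Omega>\<^sup>1(D)\<close>.
\<close>

lemma \<phi>_gluing: "z \<noteq> 0 \<Longrightarrow> z * \<phi> U0 z = Omega_bundle D z * \<phi> U1 (1 / z)"
  using gluing_at_E_source_row1(2)[OF gluing]
  by (intro Omega_numerator_gluing) (auto simp: A_eq intro: entry_holomorphic)

lemma \<sigma>_gluing: "z \<noteq> 0 \<Longrightarrow> \<sigma> U0 z = Omega_bundle D z * \<sigma> U1 (1 / z)"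
  using gluing_at_E_source_row1(1)[OF gluing] Omega_numerator_gluing[of \<sigma> "\<lambda>_. 1" D z]
  by (auto simp: A_eq intro: entry_holomorphic)

text \<open>
  As the zeros of \<open>\<phi>\<close> are simple, \<open>\<phi> = q u\<close> with \<open>q\<close> an equation of \<open>Q\<close> and \<open>u\<close> without zeros, and
  \<open>\<phi>'/u\<close> is the numerator of the logarithmic derivative.
\<close>

lemma logarithmic_derivative:
  "\<exists>C. C holomorphic_on UNIV \<and> (\<forall>x. pt c x \<notin># Q \<longrightarrow> deriv (\<phi> c) x / \<phi> c x = C x / local_eq Q c x)"
proof -
  obtain u where u: "u holomorphic_on UNIV" "\<And>x. \<phi> c x = local_eq Q c x * u x"
    using entire_divisible_by_local_eq[OF entry_holomorphic, of c Q c 1 2] zero_iff reduced by blast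
  have dQ: "(local_eq Q c has_field_derivative deriv (local_eq Q c) x) (at x)"
    and du: "(u has_field_derivative deriv u x) (at x)" for x
    using u(1) local_eq_holomorphic by (auto intro!: holomorphic_derivI[of _ UNIV])
  have d\<phi>: "deriv (\<phi> c) x = local_eq Q c x * deriv u x + deriv (local_eq Q c) x * u x" for x
    using DERIV_imp_deriv[OF DERIV_mult[OF dQ du]] by (simp add: u(2) mult.commute add.commute)
  have u_nz: "u x \<noteq> 0" for x
  proof
    assume "u x = 0"
    then have "\<phi> c x = 0"
      by (simp add: u(2))
    then have "pt c x \<in># Q"
      by (simp add: zero_iff)
    moreover from this \<open>u x = 0\<close> have "deriv (\<phi> c) x = 0"
      unfolding d\<phi> by (simp add: local_eq_eq_0_iff)
    ultimately show False
      using simple_zero by blast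
  qed
  have "(\<lambda>x. deriv (\<phi> c) x / u x) holomorphic_on UNIV"
    by (intro holomorphic_intros deriv_entry_holomorphic u u_nz)
  moreover have "deriv (\<phi> c) x / \<phi> c x = (deriv (\<phi> c) x / u x) / local_eq Q c x" for x
    by (simp add: u(2))
  ultimately show ?thesis
    by blast
qed

definition transformed :: connection_matrix where
  "transformed = push_forward P (id_sum \<phi>) A"

lemma transformed_nth:
  assumes "pt c x \<notin># P"
  shows "transformed c x $ 1 $ 1 = \<sigma> c x / local_eq D c x"
    and "transformed c x $ 1 $ 2 = 1 / local_eq D c x"
    and "transformed c x $ 2 $ 1 = \<phi> c x * B c x $ 2 $ 1 / local_eq D c x"
    and "transformed c x $ 2 $ 2 = B c x $ 2 $ 2 / local_eq D c x - deriv (\<phi> c) x / \<phi> c x"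
proof -
  have h: "id_sum \<phi> c x = lower_triangular 1 ((\<lambda>_. 0) x) (\<phi> c x)" for x
    by (simp add: id_sum_def diag2_eq_lower_triangular)
  have nz: "\<phi> c x \<noteq> 0"
    using assms zero_iff[of c x] by simp
  from push_forward_lower_triangular[where h = "id_sum \<phi>" and c = c, OF h assms one_neq_zero nz, of A] nz
  show "transformed c x $ 1 $ 1 = \<sigma> c x / local_eq D c x"
    "transformed c x $ 1 $ 2 = 1 / local_eq D c x"
    "transformed c x $ 2 $ 1 = \<phi> c x * B c x $ 2 $ 1 / local_eq D c x"
    "transformed c x $ 2 $ 2 = B c x $ 2 $ 2 / local_eq D c x - deriv (\<phi> c) x / \<phi> c x"
    by (simp_all add: transformed_def A_eq)
qed

lemma transformed_on_P: "pt c x \<in># P \<Longrightarrow> transformed c x = 0"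
  by (simp add: transformed_def push_forward_def)

lemma transformed_is_connection: "is_connection P (E_target D) transformed"
  unfolding is_connection_def
proof (intro conjI allI impI)
  fix c
  obtain C where C: "C holomorphic_on UNIV"
    "\<And>x. pt c x \<notin># Q \<Longrightarrow> deriv (\<phi> c) x / \<phi> c x = C x / local_eq Q c x"
    using logarithmic_derivative by blast
  let ?d = "local_eq D c" and ?q = "local_eq Q c"
  define B' :: "complex \<Rightarrow> mat2" where "B' = (\<lambda>x. vector [vector [\<sigma> c x * ?q x, ?q x],
    vector [\<phi> c x * B c x $ 2 $ 1 * ?q x, B c x $ 2 $ 2 * ?q x - C x * ?d x]])"
  have B'_nth: "B' x $ 1 $ 1 = \<sigma> c x * ?q x" "B' x $ 1 $ 2 = ?q x"
    "B' x $ 2 $ 1 = \<phi> c x * B c x $ 2 $ 1 * ?q x" "B' x $ 2 $ 2 = B c x $ 2 $ 2 * ?q x - C x * ?d x" for x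
    by (simp_all add: B'_def)
  have "mat_holomorphic_on B' UNIV"
    unfolding mat_holomorphic_on_def forall_2 B'_nth
    by (intro conjI holomorphic_intros entry_holomorphic local_eq_holomorphic C)
  moreover have "transformed c x $ i $ j = B' x $ i $ j / local_eq P c x" for x i j
  proof (cases "pt c x \<in># P")
    case True
    then have "local_eq P c x = 0"
      by (simp add: local_eq_eq_0_iff)
    with True show ?thesis
      by (simp add: transformed_on_P)
  next
    case False
    then have "?d x \<noteq> 0" "?q x \<noteq> 0"
      by (simp_all add: local_eq_eq_0_iff)
    then show ?thesis
      using False exhaust_2[of i] exhaust_2[of j]
      by (auto simp: transformed_nth B'_nth C(2) local_eq_union field_simps)
  qed
  ultimately show "\<exists>B'. mat_holomorphic_on B' UNIV \<and>
      (\<forall>x i j. transformed c x $ i $ j = B' x $ i $ j / local_eq P c x)"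
    by blast
next
  fix z assume z: "z \<noteq> 0 \<and> Pt z \<notin># P"
  have "\<phi> U0 z * z = Omega_bundle D z * \<phi> U1 (1 / z)" if "z \<noteq> 0" for z
    using \<phi>_gluing[OF that] by (simp only: mult.commute)
  then have "bundle_hom E_source (E_target D) (id_sum \<phi>)"
    unfolding bundle_hom_def mat_holomorphic_on_def forall_2
    by (auto simp: id_sum_def mat2_eq_iff mat2_mult_nth direct_sum_def O_bundle_def entry_holomorphic)
  moreover have "det (id_sum \<phi> U0 z) \<noteq> 0" "det (id_sum \<phi> U1 (1 / z)) \<noteq> 0"
    using z zero_iff[of U0 z] zero_iff[of U1 "1 / z"] by (auto simp: id_sum_def det_2)
  ultimately have "gluing_at (E_target D) transformed z"
    unfolding transformed_def using z
    by (intro gluing_at_push_forward[OF gluing is_bundle_O_O1 is_bundle_O_Omega]) auto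
  then show "E_target D z ** (mat (- 1 / z\<^sup>2) ** transformed U1 (1 / z)) =
      transformed U0 z ** E_target D z + mat_deriv (E_target D) z"
    by (simp add: gluing_at_def)
qed

lemma analytic_over_local_eq_D:
  assumes "f holomorphic_on UNIV" "pt c x \<notin># D"
  shows "(\<lambda>y. f y / local_eq D c y) analytic_on {x}"
  using assms local_eq_holomorphic[of D c UNIV]
  by (intro analytic_intros) (auto simp: analytic_on_holomorphic local_eq_eq_0_iff)

lemma residue_at_Q:
  assumes q: "q \<in># Q" and f: "f holomorphic_on UNIV"
    and g: "\<And>y. pt (chart_at q) y \<notin># P \<Longrightarrow>
      g y = f y / local_eq D (chart_at q) y - deriv (\<phi> (chart_at q)) y / \<phi> (chart_at q) y"
  shows "residue g (coord_at q) = - 1"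
proof (rule residue_log_derivative)
  let ?c = "chart_at q" and ?x = "coord_at q"
  have qD: "pt ?c ?x \<notin># D"
    using q disjoint by auto
  show "(\<lambda>y. f y / local_eq D ?c y) analytic_on {?x}"
    by (rule analytic_over_local_eq_D[OF f qD])
  show "(\<lambda>y. \<phi> ?c y) holomorphic_on UNIV"
    by (rule entry_holomorphic)
  show "\<phi> ?c ?x = 0" "deriv (\<phi> ?c) ?x \<noteq> 0"
    using q zero_iff[of ?c ?x] simple_zero[of ?c ?x] by auto
  show "\<forall>\<^sub>F y in at ?x. \<phi> ?c y \<noteq> 0"
    using eventually_pt_notin[of ?c Q ?x] by eventually_elim (simp add: zero_iff)
  show "\<forall>\<^sub>F y in at ?x. g y = f y / local_eq D ?c y - deriv (\<phi> ?c) y / \<phi> ?c y"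
    using eventually_pt_notin[of ?c P ?x] by eventually_elim (rule g)
qed

text \<open>
  At a point of \<open>D\<close> the leading coefficient is already nonzero in the entry \<open>(1,2)\<close>, which is
  \<open>1/d\<close>; at a point of \<open>Q\<close> the entry \<open>(2,2)\<close> has residue \<open>-1\<close>.
\<close>

lemma transformed_exact_polar_divisor: "has_exact_polar_divisor P (E_target D) transformed"
  unfolding has_exact_polar_divisor_def
proof (intro conjI ballI transformed_is_connection)
  fix p assume p: "p \<in># P"
  let ?c = "chart_at p" and ?x = "coord_at p"
  show "polar_coeff (count P p) (transformed ?c) ?x \<noteq> 0"
  proof (cases "p \<in># D")
    case True
    then have count: "count P p = count D p"
      using disjoint by (auto simp: not_in_iff)
    have "polar_coeff (count P p) (transformed ?c) ?x $ 1 $ 2 =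
        residue (\<lambda>y. (y - ?x) ^ (count D p - 1) * (1 / local_eq D ?c y)) ?x"
      unfolding polar_coeff_def count vec_lambda_beta
    proof (rule residue_cong)
      show "\<forall>\<^sub>F y in at ?x. (y - ?x) ^ (count D p - 1) * transformed ?c y $ 1 $ 2 =
          (y - ?x) ^ (count D p - 1) * (1 / local_eq D ?c y)"
        using eventually_pt_notin[of ?c P ?x] by eventually_elim (simp add: transformed_nth)
    qed simp
    then show ?thesis
      using leading_polar_coefficient_nonzero[OF True] by auto
  next
    case False
    with p have q: "p \<in># Q"
      by simp
    then have "count P p = 1"
      using False reduced[of p] by (simp add: not_in_iff le_Suc_eq flip: count_greater_zero_iff)
    then have "polar_coeff (count P p) (transformed ?c) ?x $ 2 $ 2 =
        residue (\<lambda>y. transformed ?c y $ 2 $ 2) ?x"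
      by (simp add: polar_coeff_def)
    also have "\<dots> = - 1"
      by (rule residue_at_Q[OF q entry_holomorphic]) (rule transformed_nth)
    finally show ?thesis
      by auto
  qed
qed

definition normalizer :: "chart \<Rightarrow> complex \<Rightarrow> mat2" where
  "normalizer c x = lower_triangular 1 (\<sigma> c x) 1"

definition normal_form :: connection_matrix where
  "normal_form = push_forward P normalizer transformed"

lemma normalizer_iso: "bundle_iso (E_target D) (E_target D) normalizer"
  unfolding bundle_iso_def bundle_hom_def mat_holomorphic_on_def forall_2
  by (auto simp: normalizer_def mat2_eq_iff mat2_mult_nth direct_sum_def O_bundle_def entry_holomorphic \<sigma>_gluing)

lemma normal_form_on_P: "pt c x \<in># P \<Longrightarrow> normal_form c x = 0"
  by (simp add: normal_form_def push_forward_def)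

lemma normal_form_nth:
  assumes "pt c x \<notin># P"
  shows "normal_form c x $ 1 $ 1 = 0"
    and "normal_form c x $ 1 $ 2 = 1 / local_eq D c x"
    and "normal_form c x $ 2 $ 2 = (\<sigma> c x + B c x $ 2 $ 2) / local_eq D c x - deriv (\<phi> c) x / \<phi> c x"
  using push_forward_lower_triangular[where h = normalizer and c = c,
      OF normalizer_def assms one_neq_zero one_neq_zero, of transformed]
  by (simp_all add: normal_form_def transformed_nth[OF assms] add_divide_distrib)

lemma normal_form_is_connection: "is_connection P (E_target D) normal_form"
  unfolding normal_form_def
  by (rule is_connection_push_forward_iso[OF transformed_is_connection is_bundle_O_Omega
        is_bundle_O_Omega normalizer_iso])

lemma normal_form_equivalent: "aut_equivalent P (E_target D) transformed normal_form"
  unfolding aut_equivalent_def normal_form_def using normalizer_iso by blast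

lemma normal_form_normalized: "is_normalized D normal_form"
  unfolding is_normalized_def
proof (intro conjI allI)
  show "normal_form c x $ 1 $ 1 = 0" for c x
    by (cases "pt c x \<in># P") (simp_all add: normal_form_on_P normal_form_nth)
  show "cyclic_morphism D normal_form c x = 1" for c x
    using cyclic_morphism_eq[of "\<lambda>_. 1" c P normal_form D] by (simp add: normal_form_nth)
qed

text \<open>
  An automorphism is lower triangular with diagonal \<open>(a, b)\<close> and corner \<open>f\<close>. The second normalization
  forces \<open>a = b\<close> and the first one \<open>f = b \<sigma>\<close>, so the automorphism is \<open>b\<close> times
  \<^const>\<open>normalizer\<close>, and a scalar does not change a connection.
\<close>

lemma normal_form_unique:
  assumes equiv: "aut_equivalent P (E_target D) transformed N" and normalized: "is_normalized D N"
  shows "N = normal_form"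
proof -
  obtain h where h: "bundle_iso (E_target D) (E_target D) h" and N: "N = push_forward P h transformed"
    using equiv by (auto simp: aut_equivalent_def)
  obtain a b f where f: "\<And>c. f c holomorphic_on UNIV"
    and h_eq: "\<And>c x. h c x = lower_triangular a (f c x) b"
    using endomorphism_O_Omega[OF size_D] h unfolding bundle_iso_def by blast
  have "det (h U0 0) \<noteq> 0"
    using h by (simp add: bundle_iso_def)
  then have ab: "a \<noteq> 0" "b \<noteq> 0"
    by (auto simp: h_eq)
  note N_nth = push_forward_lower_triangular[where h = h and b = "\<lambda>_. b",
      OF h_eq _ ab, of _ _ P transformed, folded N]
  have "cyclic_morphism D N U0 0 = a / b"
    using cyclic_morphism_eq[of "\<lambda>_. a / b" U0 P N D] by (simp add: N_nth transformed_nth)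
  then have "a = b"
    using normalized ab by (simp add: is_normalized_def)
  \<comment> \<open>The vanishing of the \<open>(1,1)\<close> entry determines \<open>f\<close> outside the poles, hence everywhere.\<close>
  have f_eq: "f c = (\<lambda>x. b * \<sigma> c x)" for c
  proof (rule entire_eqI[where c = c and P = P])
    fix x assume x: "pt c x \<notin># P"
    then have "local_eq D c x \<noteq> 0"
      by (simp add: local_eq_eq_0_iff)
    moreover have "\<sigma> c x / local_eq D c x - 1 / local_eq D c x * f c x / b = 0"
      using N_nth(1)[OF x] normalized by (simp add: is_normalized_def transformed_nth[OF x])
    ultimately show "f c x = b * \<sigma> c x"
      using ab by (simp add: field_simps)
  qed (auto intro!: holomorphic_intros f entry_holomorphic)
  have deriv_f: "deriv (f c) x = b * deriv (\<sigma> c) x" for c x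
    unfolding f_eq
    by (rule deriv_cmult[OF holomorphic_on_imp_differentiable_at[OF entry_holomorphic open_UNIV UNIV_I]])
  have "N c x = normal_form c x" for c x
  proof (cases "pt c x \<in># P")
    case True
    then show ?thesis
      by (simp add: N push_forward_def normal_form_on_P)
  next
    case False
    note normal_nth = push_forward_lower_triangular[where h = normalizer and c = c,
        OF normalizer_def False one_neq_zero one_neq_zero, of transformed, folded normal_form_def]
    show ?thesis
      unfolding mat2_eq_iff N_nth[OF False] normal_nth deriv_f unfolding f_eq \<open>a = b\<close>
    proof (intro conjI)
      let ?T = "transformed c x" and ?s = "\<sigma> c x" and ?s' = "deriv (\<sigma> c) x"
      \<comment> \<open>Numerators and denominators in this entry are homogeneous of the same degree in \<open>b\<close>.\<close>
      have 1: "b * ?s * ?T $ 1 $ 1 + b * ?T $ 2 $ 1 - b * ?s' = b * (?s * ?T $ 1 $ 1 + ?T $ 2 $ 1 - ?s')"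
        and 2: "(b * ?s * ?T $ 1 $ 2 + b * ?T $ 2 $ 2) * (b * ?s) = b * b * ((?s * ?T $ 1 $ 2 + ?T $ 2 $ 2) * ?s)"
        by (simp_all add: algebra_simps)
      show "(b * ?s * ?T $ 1 $ 1 + b * ?T $ 2 $ 1 - b * ?s') / b
          - (b * ?s * ?T $ 1 $ 2 + b * ?T $ 2 $ 2 - deriv (\<lambda>_. b) x) * (b * ?s) / (b * b) =
        (?s * ?T $ 1 $ 1 + 1 * ?T $ 2 $ 1 - ?s') / 1
          - (?s * ?T $ 1 $ 2 + 1 * ?T $ 2 $ 2 - deriv (\<lambda>_. 1) x) * ?s / (1 * 1)"
        unfolding 1 deriv_const diff_zero 2 using ab by simp
    qed (use ab in simp_all)
  qed
  then show ?thesis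
    by blast
qed

lemma normal_form_residue:
  assumes q: "q \<in># Q"
  shows "residue_matrix normal_form q $ 1 $ 1 = 0" "residue_matrix normal_form q $ 1 $ 2 = 0"
    "residue_matrix normal_form q $ 2 $ 2 = - 1"
proof -
  let ?c = "chart_at q" and ?x = "coord_at q"
  have nth: "residue_matrix normal_form q $ i $ j = residue (\<lambda>y. normal_form ?c y $ i $ j) ?x" for i j
    by (simp add: residue_matrix_def polar_coeff_def)
  have qD: "pt ?c ?x \<notin># D"
    using q disjoint by auto
  have off: "\<forall>\<^sub>F y in at ?x. pt ?c y \<notin># P"
    by (rule eventually_pt_notin)
  have "residue (\<lambda>y. normal_form ?c y $ 1 $ 1) ?x = residue (\<lambda>y. 0) ?x"
    by (rule residue_cong) (use off in \<open>auto simp: normal_form_nth elim: eventually_mono\<close>)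
  then show "residue_matrix normal_form q $ 1 $ 1 = 0"
    by (simp add: nth residue_analytic)
  have "residue (\<lambda>y. normal_form ?c y $ 1 $ 2) ?x = residue (\<lambda>y. 1 / local_eq D ?c y) ?x"
    by (rule residue_cong) (use off in \<open>auto simp: normal_form_nth elim: eventually_mono\<close>)
  then show "residue_matrix normal_form q $ 1 $ 2 = 0"
    using residue_analytic[OF analytic_over_local_eq_D[OF _ qD, of "\<lambda>_. 1"]] by (simp add: nth)
  show "residue_matrix normal_form q $ 2 $ 2 = - 1"
    unfolding nth
    by (rule residue_at_Q[OF q, of "\<lambda>y. \<sigma> ?c y + B ?c y $ 2 $ 2"])
      (intro holomorphic_intros entry_holomorphic, rule normal_form_nth)
qed

end

lemma eigen_lower_triangular:
  fixes M :: mat2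
  assumes "M $ 1 $ 1 = 0" "M $ 1 $ 2 = 0" "M $ 2 $ 2 = - 1"
  shows "eigenvalues M = {- 1, 0}" "M *v v = - v \<Longrightarrow> v $ 1 = 0"
proof -
  have mult: "M *v v = a *s v \<longleftrightarrow> a * v $ 1 = 0 \<and> M $ 2 $ 1 * v $ 1 - v $ 2 = a * v $ 2" for v a
    using assms by (auto simp: vec_eq_iff forall_2 matrix_vector_mult_def sum_2)
  have "a \<in> {- 1, 0}" if "v \<noteq> 0" "M *v v = a *s v" for v a
  proof (rule ccontr)
    assume a: "a \<notin> {- 1, 0}"
    then have "v $ 1 = 0"
      using that mult by auto
    moreover from this have "a * v $ 2 = - v $ 2"
      using that mult[of v a] by simp
    then have "(a + 1) * v $ 2 = 0"
      by (simp add: distrib_right)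
    moreover have "a + 1 \<noteq> 0"
      using a by (simp add: add_eq_0_iff2)
    ultimately show False
      using that by (auto simp: vec_eq_iff forall_2)
  qed
  moreover have "- 1 \<in> eigenvalues M"
    unfolding eigenvalues_def mult
    by (auto intro!: exI[of _ "vector [0, 1]"] simp: vec_eq_iff forall_2)
  moreover have "0 \<in> eigenvalues M"
    unfolding eigenvalues_def mult
    by (auto intro!: exI[of _ "vector [1, M $ 2 $ 1]"] simp: vec_eq_iff forall_2)
  ultimately show "eigenvalues M = {- 1, 0}"
    by (auto simp: eigenvalues_def)
  show "v $ 1 = 0" if "M *v v = - v"
    using mult[of v "- 1"] that by simp
qed

theorem proposition3:
  fixes D Q :: "p1 multiset"
    and \<Lambda> :: formal_data
    and E :: clutching
    and nabla nabla1 nabla' :: connection_matrix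
    and \<psi> :: "chart \<Rightarrow> complex \<Rightarrow> mat2"
  assumes "size D \<ge> 3"
    and "Lambda_connection D \<Lambda> E nabla"
    and "bundle_iso E E_source \<psi>"
    and "nabla1 = push_forward D \<psi> nabla"
    and "\<not> second_factor_invariant nabla1"
    and "Q = App D nabla1"
    and "\<forall>p. count Q p \<le> 1"
    and "set_mset Q \<inter> set_mset D = {}"
    and "nabla' = push_forward (D + Q) (id_sum (cyclic_morphism D nabla1)) nabla1"
  shows "has_exact_polar_divisor (D + Q) (E_target D) nabla' \<and>
         (\<exists>!nabla0. is_connection (D + Q) (E_target D) nabla0 \<and>
           aut_equivalent (D + Q) (E_target D) nabla' nabla0 \<and> is_normalized D nabla0) \<and>
         (\<forall>nabla0. is_connection (D + Q) (E_target D) nabla0 \<and>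
           aut_equivalent (D + Q) (E_target D) nabla' nabla0 \<and> is_normalized D nabla0 \<longrightarrow>
           (\<forall>q\<in>#Q. eigenvalues (residue_matrix nabla0 q) = {- 1, 0} \<and>
              (\<forall>v. residue_matrix nabla0 q *v v = - v \<longrightarrow> v $ 1 = 0)))"
proof -
  have conn: "is_connection D E_source nabla1"
    unfolding assms(4) using assms(2,3) is_bundle_O_O1
    by (intro is_connection_push_forward_iso) (auto simp: Lambda_connection_def)
  then have "\<forall>c. \<exists>B. mat_holomorphic_on B UNIV \<and> (\<forall>x i j. nabla1 c x $ i $ j = B x $ i $ j / local_eq D c x)"
    by (simp add: is_connection_def)
  then obtain B where B: "\<And>c. mat_holomorphic_on (B c) UNIV"
    "\<And>c x i j. nabla1 c x $ i $ j = B c x $ i $ j / local_eq D c x"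
    by metis
  let ?\<phi> = "\<lambda>c x. B c x $ 1 $ 2"
  have hol: "?\<phi> c holomorphic_on UNIV" for c
    using B(1) by (simp add: mat_holomorphic_on_def)
  have cyclic: "cyclic_morphism D nabla1 = ?\<phi>"
    by (rule ext) (rule cyclic_morphism_eq[OF hol B(2)])
  interpret section_of_line_bundle ?\<phi> "\<lambda>z. z" "Omega_bundle D"
  proof
    show "z * ?\<phi> U0 z = Omega_bundle D z * ?\<phi> U1 (1 / z)" if "z \<noteq> 0" for z
      using gluing_at_E_source_row1(2)[OF is_connection_gluing[OF conn]] that
      by (intro Omega_numerator_gluing) (auto simp: B(2) hol)
    show "\<exists>c x. ?\<phi> c x \<noteq> 0"
      using assms(5) by (auto simp: second_factor_invariant_def B(2))
  qed (auto simp: hol Omega_bundle_holomorphic Omega_bundle_nonzero)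
  have Q: "Q = divisor_of ?\<phi>"
    by (simp add: assms(6) App_def cyclic)
  interpret cyclic_connection D Q nabla1 B
    using assms(1,7,8) B is_connection_gluing[OF conn] zero_iff_in_divisor deriv_nonzero_at_simple_zero
    by unfold_locales (auto simp: Q)
  have nabla': "nabla' = transformed"
    by (simp add: assms(9) cyclic transformed_def)
  show ?thesis
    unfolding nabla'
  proof (intro conjI allI impI ballI)
    show "has_exact_polar_divisor (D + Q) (E_target D) transformed"
      by (rule transformed_exact_polar_divisor)
    show "\<exists>!nabla0. is_connection (D + Q) (E_target D) nabla0 \<and>
        aut_equivalent (D + Q) (E_target D) transformed nabla0 \<and> is_normalized D nabla0"
      using normal_form_is_connection normal_form_equivalent normal_form_normalized normal_form_unique
      by blast
    fix nabla0 q
    assume nabla0: "is_connection (D + Q) (E_target D) nabla0 \<and>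
      aut_equivalent (D + Q) (E_target D) transformed nabla0 \<and> is_normalized D nabla0" and q: "q \<in># Q"
    then have "nabla0 = normal_form"
      using normal_form_unique by blast
    then show "eigenvalues (residue_matrix nabla0 q) = {- 1, 0}"
      "residue_matrix nabla0 q *v v = - v \<Longrightarrow> v $ 1 = 0" for v
      using eigen_lower_triangular[OF normal_form_residue[OF q]] by blast+
  qed
qed

end
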